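(* Let $f:X\to Y$ be a continuous surjective map between compact Hausdorff spaces. Then the map $Hf:HX\to HY$ is open if and only if $f$ is open.
   Context: For a compact Hausdorff space $X$, let $HM(X)$ be the set of all maps $\alpha:[0,1)\to X$ for which there exist $0=t_0<t_1<\dots<t_n=1$ such that $\alpha$ is constant on each $[t_i,t_{i+1})$. Let $C(X)$ be the set of continuous real-valued functions on $X$. For $\varphi\in C(X)$ and $0\le a<b\le 1$ define $\varphi_{(a,b)}:HM(X)\to\mathbb{R}$ by $\varphi_{(a,b)}(\alpha)=\frac{1}{b-a}\int_a^b\varphi(\alpha(t))\,dt$, and let $S_{HM}(X)$ be the set of all such functions. The map $\alpha\mapsto(\varphi_{(a,b)}(\alpha))_{\varphi_{(a,b)}\in S_{HM}(X)}$ embeds $HM(X)$ into the product $\prod_{\varphi_{(a,b)}\in S_{HM}(X)}[\min\varphi,\max\varphi]$ (product topology); $HX$ is the closure of the image of $HM(X)$ in this product (a compact Hausdorff space), and $p_{\varphi_{(a,b)}}:HX\to\mathbb{R}$ denotes the restriction of the coordinate projection. For a continuous map $f:X\to Y$, $Hf:HX\to HY$ is the unique continuous map with $p_{\varphi_{(a,b)}}\circ Hf=p_{(\varphi\circ f)_{(a,b)}}$ for all $\varphi\in C(Y)$ and $0\le a<b\le 1$; it extends $\alpha\mapsto f\circ\alpha$ on $HM(X)$. *)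

theory Defs
  imports "HOL-Analysis.Analysis"
begin

definition HM :: "'a topology \<Rightarrow> (real \<Rightarrow> 'a) set" where
  "HM X = {\<alpha>. (\<forall>t\<in>{0..<1}. \<alpha> t \<in> topspace X) \<and> (\<forall>t. t \<notin> {0..<1} \<longrightarrow> \<alpha> t = undefined) \<and>
     (\<exists>n::nat. \<exists>ts::nat \<Rightarrow> real. ts 0 = 0 \<and> ts n = 1 \<and> (\<forall>i<n. ts i < ts (Suc i)) \<and>
        (\<forall>i<n. \<forall>t\<in>{ts i..<ts (Suc i)}. \<alpha> t = \<alpha> (ts i)))}"

definition HM_fun :: "'a topology \<Rightarrow> ('a \<Rightarrow> real) \<Rightarrow> real \<Rightarrow> real \<Rightarrow> (real \<Rightarrow> 'a) \<Rightarrow> real" where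
  "HM_fun X \<phi> a b = (\<lambda>\<alpha>\<in>HM X. (1 / (b - a)) * integral {a..b} (\<lambda>t. \<phi> (\<alpha> t)))"

definition SHM :: "'a topology \<Rightarrow> ((real \<Rightarrow> 'a) \<Rightarrow> real) set" where
  "SHM X = {HM_fun X \<phi> a b | \<phi> a b. continuous_map X euclideanreal \<phi> \<and> 0 \<le> a \<and> a < b \<and> b \<le> 1}"

text \<open>The coordinate interval [min phi, max phi] for s = phi_(a,b)
  (independent of the chosen representative phi, since phi = s on constant maps).\<close>
definition Hcoord_range :: "'a topology \<Rightarrow> ((real \<Rightarrow> 'a) \<Rightarrow> real) \<Rightarrow> real set" where
  "Hcoord_range X s =
     (let \<phi> = (SOME \<phi>. \<exists>a b. continuous_map X euclideanreal \<phi> \<and> 0 \<le> a \<and> a < b \<and> b \<le> 1 \<and>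
                          s = HM_fun X \<phi> a b)
      in {Inf (\<phi> ` topspace X) .. Sup (\<phi> ` topspace X)})"

definition Hprod :: "'a topology \<Rightarrow> (((real \<Rightarrow> 'a) \<Rightarrow> real) \<Rightarrow> real) topology" where
  "Hprod X = product_topology (\<lambda>s. subtopology euclideanreal (Hcoord_range X s)) (SHM X)"

definition Hembed :: "'a topology \<Rightarrow> (real \<Rightarrow> 'a) \<Rightarrow> ((real \<Rightarrow> 'a) \<Rightarrow> real) \<Rightarrow> real" where
  "Hembed X \<alpha> = (\<lambda>s\<in>SHM X. s \<alpha>)"

definition HX :: "'a topology \<Rightarrow> (((real \<Rightarrow> 'a) \<Rightarrow> real) \<Rightarrow> real) topology" where
  "HX X = subtopology (Hprod X) (Hprod X closure_of (Hembed X ` HM X))"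

text \<open>Hf: the unique continuous map HX -> HY with p_{psi_(a,b)} o Hf = p_{(psi o f)_(a,b)}
  (taken extensional on topspace (HX X) so that it is unique as a HOL function).\<close>
definition Hmap :: "'a topology \<Rightarrow> 'b topology \<Rightarrow> ('a \<Rightarrow> 'b)
     \<Rightarrow> (((real \<Rightarrow> 'a) \<Rightarrow> real) \<Rightarrow> real) \<Rightarrow> (((real \<Rightarrow> 'b) \<Rightarrow> real) \<Rightarrow> real)" where
  "Hmap X Y f = (THE g. g \<in> extensional (topspace (HX X)) \<and> continuous_map (HX X) (HX Y) g \<and>
     (\<forall>\<psi> a b. continuous_map Y euclideanreal \<psi> \<and> 0 \<le> a \<and> a < b \<and> b \<le> 1 \<longrightarrow>
        (\<forall>z\<in>topspace (HX X). g z (HM_fun Y \<psi> a b) = z (HM_fun X (\<psi> \<circ> f) a b))))"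

end

theory Submission
  imports Defs
begin

text \<open>
  The space \<open>HX\<close> is compact and convex: two paths are mixed in a prescribed proportion by switching
  between them on each common interval of constancy. The map \<open>Hf\<close> is affine, so its fibres are convex, and openness of \<open>Hf\<close> follows from the
  continuity of all fibrewise suprema \<open>w \<mapsto> sup {l z | Hf z = w}\<close> of linear functionals \<open>l\<close>: a fibre
  over a point near \<open>Hf c\<close> that stayed away from \<open>c\<close> could be separated from \<open>c\<close> by one of finitely
  many functionals, and its supremum would jump. A linear functional is the integral along the path of an
  integrand that is piecewise constant in time, and its fibrewise supremum is the integral of the
  fibrewise suprema of the integrand with respect to \<open>f\<close>, which are continuous on \<open>Y\<close> when \<open>f\<close> is open.

  Conversely, a Urysohn function \<open>\<phi>\<close> for a point and its neighbourhood \<open>U\<close> cuts out the open set of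
  those \<open>z\<close> whose mean of \<open>\<phi>\<close> exceeds 1/2. Restricting its image under \<open>Hf\<close> to constant paths gives
  an open set of points \<open>y\<close>, and each of their fibres meets \<open>U\<close>.
\<close>

section \<open>Fibrewise suprema\<close>

definition fibre_Sup :: "'a topology \<Rightarrow> ('a \<Rightarrow> 'b) \<Rightarrow> ('a \<Rightarrow> real) \<Rightarrow> 'b \<Rightarrow> real" where
  "fibre_Sup X f g y = Sup (g ` {x \<in> topspace X. f x = y})"

lemma fibre_Sup_eqI:
  assumes "x \<in> topspace X" "f x = y" "g x = r"
    and "\<And>x. x \<in> topspace X \<Longrightarrow> f x = y \<Longrightarrow> g x \<le> r"
  shows "fibre_Sup X f g y = r"
  unfolding fibre_Sup_def by (rule cSup_eq_maximum) (use assms in auto)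

locale compact_map =
  fixes X :: "'a topology" and Y :: "'b topology" and f :: "'a \<Rightarrow> 'b"
  assumes compact_domain: "compact_space X"
    and compact_codomain: "compact_space Y"
    and Hausdorff_codomain: "Hausdorff_space Y"
    and continuous: "continuous_map X Y f"
begin

lemma image_in_topspace: "x \<in> topspace X \<Longrightarrow> f x \<in> topspace Y"
  using continuous by (auto simp: continuous_map_def)

lemma closedin_image: "closedin X C \<Longrightarrow> closedin Y (f ` C)"
  using continuous_imp_closed_map[OF continuous compact_domain Hausdorff_codomain]
  by (simp add: closed_map_def)

lemma compactin_fibre:
  assumes "y \<in> topspace Y"
  shows "compactin X {x \<in> topspace X. f x = y}"
proof -
  have "closedin X {x \<in> topspace X. f x \<in> {y}}"
    by (rule closedin_continuous_map_preimage[OF continuous])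
      (use assms Hausdorff_codomain in \<open>simp add: closedin_Hausdorff_sing_eq\<close>)
  then show ?thesis using closedin_compact_space[OF compact_domain] by simp
qed

lemma compact_image_fibre:
  assumes "continuous_map X euclideanreal g" "y \<in> topspace Y"
  shows "compact (g ` {x \<in> topspace X. f x = y})"
  using image_compactin[OF compactin_fibre[OF assms(2)] assms(1)] by simp

lemma fibre_Sup_attained:
  assumes "continuous_map X euclideanreal g" "y \<in> f ` topspace X"
  obtains x where "x \<in> topspace X" "f x = y" "g x = fibre_Sup X f g y"
proof -
  let ?F = "{x \<in> topspace X. f x = y}"
  have "compact (g ` ?F)" "g ` ?F \<noteq> {}"
    using compact_image_fibre[OF assms(1)] assms(2) image_in_topspace by auto
  then obtain x where "x \<in> ?F" "\<forall>r\<in>g ` ?F. r \<le> g x"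
    using compact_attains_sup[of "g ` ?F"] by auto
  then show thesis using that[of x] fibre_Sup_eqI[of x X f y g] by simp
qed

lemma fibre_Sup_upper:
  assumes "continuous_map X euclideanreal g" "x \<in> topspace X"
  shows "g x \<le> fibre_Sup X f g (f x)"
  unfolding fibre_Sup_def
  using compact_image_fibre[OF assms(1) image_in_topspace[OF assms(2)]] assms(2)
  by (intro cSup_upper) (auto simp: compact_imp_bounded bounded_imp_bdd_above)

end

locale compact_surjection = compact_map +
  assumes surjective: "f ` topspace X = topspace Y"
begin

lemma continuous_map_fibre_Sup:
  assumes "open_map X Y f" "continuous_map X euclideanreal g"
  shows "continuous_map Y euclideanreal (fibre_Sup X f g)"
  unfolding continuous_map_upper_lower_semicontinuous_lt
proof (intro allI conjI)
  have superlevel: "{y \<in> topspace Y. fibre_Sup X f g y \<in> A} = f ` {x \<in> topspace X. g x \<in> A}"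
    if up: "\<And>r s. r \<in> A \<Longrightarrow> r \<le> s \<Longrightarrow> s \<in> A" for A
  proof (intro equalityI subsetI)
    fix y assume y: "y \<in> {y \<in> topspace Y. fibre_Sup X f g y \<in> A}"
    then obtain x where "x \<in> topspace X" "f x = y" "g x = fibre_Sup X f g y"
      using fibre_Sup_attained[OF assms(2), of y] surjective by auto
    with y show "y \<in> f ` {x \<in> topspace X. g x \<in> A}" by auto
  next
    fix y assume "y \<in> f ` {x \<in> topspace X. g x \<in> A}"
    then obtain x where "x \<in> topspace X" "g x \<in> A" "y = f x" by blast
    then show "y \<in> {y \<in> topspace Y. fibre_Sup X f g y \<in> A}"
      using up[OF _ fibre_Sup_upper[OF assms(2)]] image_in_topspace by simp
  qed
  fix a :: real
  have "openin X {x \<in> topspace X. g x \<in> {a<..}}"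
    by (rule openin_continuous_map_preimage[OF assms(2)]) simp
  then have "openin Y {y \<in> topspace Y. fibre_Sup X f g y \<in> {a<..}}"
    using assms(1) by (subst superlevel) (auto simp: open_map_def)
  then show "openin Y {y \<in> topspace Y. a < fibre_Sup X f g y}" by simp
  have "closedin X {x \<in> topspace X. g x \<in> {a..}}"
    by (rule closedin_continuous_map_preimage[OF assms(2)]) simp
  then have "closedin Y {y \<in> topspace Y. fibre_Sup X f g y \<in> {a..}}"
    by (subst superlevel) (auto intro: closedin_image)
  moreover have "{y \<in> topspace Y. fibre_Sup X f g y < a} =
      topspace Y - {y \<in> topspace Y. fibre_Sup X f g y \<in> {a..}}"
    by auto
  ultimately show "openin Y {y \<in> topspace Y. fibre_Sup X f g y < a}" by auto
qed

end

lemma Urysohn_point: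
  fixes r :: real
  assumes "compact_space X" "Hausdorff_space X" "x \<in> topspace X" "closedin X C" "x \<notin> C" "0 \<le> r"
  obtains \<phi> where "continuous_map X euclideanreal \<phi>" "\<phi> x = 0"
    "\<And>u. u \<in> topspace X \<Longrightarrow> 0 \<le> \<phi> u" "\<And>u. u \<in> C \<Longrightarrow> \<phi> u = r"
proof -
  have "normal_space X"
    using assms(1,2) compact_Hausdorff_or_regular_imp_normal_space by blast
  moreover have "closedin X {x}" using assms(2,3) by (simp add: closedin_Hausdorff_sing_eq)
  ultimately obtain \<phi> where \<phi>: "continuous_map X (top_of_set {0..r}) \<phi>" "\<phi> ` {x} \<subseteq> {0}" "\<phi> ` C \<subseteq> {r}"
    using Urysohn_lemma[of X "{x}" C 0 r] assms(4-6) by auto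
  show thesis
  proof
    show "continuous_map X euclideanreal \<phi>" "\<And>u. u \<in> topspace X \<Longrightarrow> 0 \<le> \<phi> u"
      using \<phi>(1) by (auto simp: continuous_map_in_subtopology Pi_iff)
  qed (use \<phi>(2,3) in auto)
qed

section \<open>Compact convex sets of real families\<close>

definition coordinate_ball :: "'i set \<Rightarrow> 'i set \<Rightarrow> ('i \<Rightarrow> real) \<Rightarrow> real \<Rightarrow> ('i \<Rightarrow> real) set" where
  "coordinate_ball S I u e = {v \<in> extensional S. \<forall>i\<in>I. \<bar>v i - u i\<bar> < e}"

lemma openin_coordinate_ball:
  assumes "finite I" "I \<subseteq> S"
  shows "openin (powertop_real S) (coordinate_ball S I u e)"
proof -
  have "coordinate_ball S I u e = PiE S (\<lambda>i. if i \<in> I then ball (u i) e else UNIV)"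
    using assms(2)
    by (auto simp: coordinate_ball_def PiE_iff extensional_def dist_real_def abs_minus_commute
        split: if_splits)
  moreover have "finite {i \<in> S. (if i \<in> I then ball (u i) e else UNIV) \<noteq> UNIV}"
    by (rule finite_subset[OF _ assms(1)]) auto
  ultimately show ?thesis by (auto simp: openin_PiE_gen)
qed

lemma openin_powertop_real_contains_coordinate_ball:
  assumes "openin (powertop_real S) W" "u \<in> W"
  obtains I e where "finite I" "I \<subseteq> S" "e > 0" "coordinate_ball S I u e \<subseteq> W"
proof -
  obtain U where U: "finite {i \<in> S. U i \<noteq> UNIV}" "\<And>i. i \<in> S \<Longrightarrow> open (U i)" "u \<in> PiE S U" "PiE S U \<subseteq> W"
    using assms unfolding openin_product_topology_alt by auto
  define I where "I = {i \<in> S. U i \<noteq> UNIV}"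
  have "\<exists>d>0. \<forall>r. \<bar>r - u i\<bar> < d \<longrightarrow> r \<in> U i" if "i \<in> I" for i
    using U(2,3) that unfolding I_def open_dist dist_real_def by (auto simp: PiE_iff)
  then obtain d where d: "\<And>i. i \<in> I \<Longrightarrow> d i > 0" "\<And>i r. i \<in> I \<Longrightarrow> \<bar>r - u i\<bar> < d i \<Longrightarrow> r \<in> U i"
    by metis
  define e where "e = Min (insert 1 (d ` I))"
  have "finite I" using U(1) by (simp add: I_def)
  then have e: "e > 0" "\<And>i. i \<in> I \<Longrightarrow> e \<le> d i" using d(1) by (auto simp: e_def)
  have "v i \<in> U i" if "v \<in> coordinate_ball S I u e" "i \<in> S" for v i
  proof (cases "i \<in> I")
    case True
    then show ?thesis using that(1) d(2)[OF True] e(2)[OF True] by (force simp: coordinate_ball_def)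
  qed (use that in \<open>simp add: I_def\<close>)
  then have "coordinate_ball S I u e \<subseteq> PiE S U"
    by (auto simp: coordinate_ball_def PiE_iff extensional_def)
  then show thesis using that[OF \<open>finite I\<close> _ e(1)] U(4) by (auto simp: I_def)
qed

lemma in_closure_of_powertop_real:
  assumes "A \<subseteq> extensional S"
  shows "u \<in> powertop_real S closure_of A \<longleftrightarrow>
    u \<in> extensional S \<and> (\<forall>I e. finite I \<and> I \<subseteq> S \<and> e > 0 \<longrightarrow> (\<exists>v\<in>A. \<forall>i\<in>I. \<bar>v i - u i\<bar> < e))"
proof (intro iffI conjI allI impI; (elim conjE)?)
  assume u: "u \<in> powertop_real S closure_of A"
  then show ext: "u \<in> extensional S" by (auto simp: in_closure_of PiE_iff)
  fix I and e :: real assume "finite I" "I \<subseteq> S" "e > 0"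
  then have "openin (powertop_real S) (coordinate_ball S I u e)" "u \<in> coordinate_ball S I u e"
    using ext openin_coordinate_ball by (blast, simp add: coordinate_ball_def)
  then obtain v where "v \<in> A" "v \<in> coordinate_ball S I u e"
    using u unfolding in_closure_of by blast
  then show "\<exists>v\<in>A. \<forall>i\<in>I. \<bar>v i - u i\<bar> < e" by (auto simp: coordinate_ball_def)
next
  assume u: "u \<in> extensional S"
    and near: "\<forall>I e. finite I \<and> I \<subseteq> S \<and> e > 0 \<longrightarrow> (\<exists>v\<in>A. \<forall>i\<in>I. \<bar>v i - u i\<bar> < e)"
  have "\<exists>v. v \<in> A \<and> v \<in> W" if W: "openin (powertop_real S) W" "u \<in> W" for W
  proof -
    obtain I e where I: "finite I" "I \<subseteq> S" "e > 0" "coordinate_ball S I u e \<subseteq> W"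
      using openin_powertop_real_contains_coordinate_ball[OF W] .
    then obtain v where "v \<in> A" "\<forall>i\<in>I. \<bar>v i - u i\<bar> < e" using near by blast
    then show ?thesis using I(4) assms by (auto simp: coordinate_ball_def)
  qed
  then show "u \<in> powertop_real S closure_of A" using u by (auto simp: in_closure_of PiE_iff)
qed

lemma continuous_map_linear_functional:
  assumes "finite I" "I \<subseteq> S"
  shows "continuous_map (powertop_real S) euclideanreal (\<lambda>u. \<Sum>i\<in>I. l i * u i)"
  using assms by (intro continuous_map_sum continuous_map_real_mult_left continuous_map_product_projection) auto

definition convex_family :: "'i set \<Rightarrow> ('i \<Rightarrow> real) set \<Rightarrow> bool" where
  "convex_family S K \<longleftrightarrow>
     (\<forall>u\<in>K. \<forall>v\<in>K. \<forall>\<tau>\<in>{0..1}. (\<lambda>i\<in>S. (1 - \<tau>) * u i + \<tau> * v i) \<in> K)"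

lemma nearest_point_obtuse_angle:
  fixes u v :: "'i \<Rightarrow> real"
  assumes nearest: "\<And>\<tau>. 0 < \<tau> \<Longrightarrow> \<tau> \<le> 1 \<Longrightarrow> (\<Sum>i\<in>I. (u i)\<^sup>2) \<le> (\<Sum>i\<in>I. ((1 - \<tau>) * u i + \<tau> * v i)\<^sup>2)"
  shows "(\<Sum>i\<in>I. (u i)\<^sup>2) \<le> (\<Sum>i\<in>I. u i * v i)"
proof -
  define p where "p = (\<Sum>i\<in>I. u i * (v i - u i))"
  define q where "q = (\<Sum>i\<in>I. (v i - u i)\<^sup>2)"
  have slope: "0 \<le> 2 * p + \<tau> * q" if \<tau>: "0 < \<tau>" "\<tau> \<le> 1" for \<tau>
  proof -
    have "(\<Sum>i\<in>I. ((1 - \<tau>) * u i + \<tau> * v i)\<^sup>2) =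
        (\<Sum>i\<in>I. (u i)\<^sup>2 + 2 * \<tau> * (u i * (v i - u i)) + \<tau>\<^sup>2 * (v i - u i)\<^sup>2)"
      by (rule sum.cong) (simp_all add: power2_eq_square algebra_simps)
    also have "\<dots> = (\<Sum>i\<in>I. (u i)\<^sup>2) + 2 * \<tau> * p + \<tau>\<^sup>2 * q"
      by (simp add: p_def q_def sum.distrib sum_distrib_left)
    also have "\<dots> = (\<Sum>i\<in>I. (u i)\<^sup>2) + \<tau> * (2 * p + \<tau> * q)"
      by (simp add: power2_eq_square algebra_simps)
    finally have "0 \<le> \<tau> * (2 * p + \<tau> * q)" using nearest[OF \<tau>] by simp
    then show ?thesis using \<tau>(1) by (simp add: zero_le_mult_iff)
  qed
  have "((\<lambda>\<tau>. 2 * p + \<tau> * q) \<longlongrightarrow> 2 * p + 0 * q) (at_right 0)"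
    by (intro tendsto_intros)
  moreover have "\<forall>\<^sub>F \<tau> in at_right 0. 0 \<le> 2 * p + \<tau> * q"
    unfolding eventually_at_right_field using slope by (intro exI[of _ 1]) auto
  ultimately have "0 \<le> p"
    using tendsto_lowerbound[OF _ _ trivial_limit_at_right_real] by fastforce
  then show ?thesis
    by (simp add: p_def power2_eq_square right_diff_distrib sum_subtractf)
qed

lemma compact_convex_family_point_near:
  assumes "compactin (powertop_real S) F" "F \<noteq> {}" "convex_family S F" "finite I" "I \<subseteq> S"
    and descent: "\<And>u. u \<in> F \<Longrightarrow> \<exists>v\<in>F. (\<Sum>i\<in>I. (u i - c i) * (v i - c i)) < e"
  shows "\<exists>u\<in>F. (\<Sum>i\<in>I. (u i - c i)\<^sup>2) < e"
proof -
  define d where "d u = (\<Sum>i\<in>I. (u i - c i)\<^sup>2)" for u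
  have "continuous_map (powertop_real S) euclideanreal d"
    unfolding d_def power2_eq_square using assms(4,5)
    by (intro continuous_map_sum continuous_map_real_mult continuous_map_diff
        continuous_map_product_projection) auto
  then have "compact (d ` F)" using image_compactin[OF assms(1)] by fastforce
  then obtain u where u: "u \<in> F" "\<And>v. v \<in> F \<Longrightarrow> d u \<le> d v"
    using compact_attains_inf[of "d ` F"] assms(2) by auto
  obtain v where v: "v \<in> F" "(\<Sum>i\<in>I. (u i - c i) * (v i - c i)) < e" using descent[OF u(1)] ..
  have "d u \<le> (\<Sum>i\<in>I. (u i - c i) * (v i - c i))"
    unfolding d_def
  proof (rule nearest_point_obtuse_angle)
    fix \<tau> :: real assume "0 < \<tau>" "\<tau> \<le> 1"
    then have "(\<lambda>i\<in>S. (1 - \<tau>) * u i + \<tau> * v i) \<in> F"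
      using assms(3) u(1) v(1) by (simp add: convex_family_def)
    then have "d u \<le> d (\<lambda>i\<in>S. (1 - \<tau>) * u i + \<tau> * v i)" by (rule u(2))
    also have "\<dots> = (\<Sum>i\<in>I. ((1 - \<tau>) * (u i - c i) + \<tau> * (v i - c i))\<^sup>2)"
      unfolding d_def using assms(5) by (intro sum.cong) (auto simp: algebra_simps)
    finally show "(\<Sum>i\<in>I. (u i - c i)\<^sup>2) \<le> (\<Sum>i\<in>I. ((1 - \<tau>) * (u i - c i) + \<tau> * (v i - c i))\<^sup>2)"
      by (simp add: d_def)
  qed
  then show ?thesis using u(1) v(2) unfolding d_def by (meson le_less_trans)
qed

lemma compactin_powertop_real_bounded:
  assumes "compactin (powertop_real S) K" "finite I" "I \<subseteq> S"
  obtains R where "\<And>u i. u \<in> K \<Longrightarrow> i \<in> I \<Longrightarrow> \<bar>u i\<bar> \<le> R"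
proof -
  have "bounded ((\<lambda>u. u i) ` K)" if "i \<in> I" for i
    using image_compactin[OF assms(1) continuous_map_product_projection[of i S]] assms(3) that
    by (auto intro: compact_imp_bounded)
  then have "bounded (\<Union>i\<in>I. (\<lambda>u. u i) ` K)" using assms(2) by blast
  then show thesis using that unfolding bounded_iff by fastforce
qed

lemma finite_coordinate_net:
  assumes "compactin (powertop_real S) K" "finite I" "I \<subseteq> S" "d > 0"
  obtains N where "finite N" "N \<subseteq> K" "K \<subseteq> (\<Union>v\<in>N. coordinate_ball S I v d)"
proof -
  have "K \<subseteq> \<Union> ((\<lambda>v. coordinate_ball S I v d) ` K)"
    using compactin_subset_topspace[OF assms(1)] assms(4) by (force simp: coordinate_ball_def PiE_iff)
  then obtain \<F> where \<F>: "finite \<F>" "\<F> \<subseteq> (\<lambda>v. coordinate_ball S I v d) ` K" "K \<subseteq> \<Union> \<F>"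
    using compactinD[OF assms(1)] openin_coordinate_ball[OF assms(2,3)]
    by (metis (no_types, lifting) imageE)
  then show thesis using finite_subset_image[OF \<F>(1,2)] that by metis
qed

lemma finite_net_of_directions:
  assumes "compactin (powertop_real S) K" "finite I" "I \<subseteq> S" "e > 0" "c \<in> K"
  obtains N where "finite N" "N \<subseteq> K"
    "\<And>u. u \<in> K \<Longrightarrow> \<exists>v\<in>N. \<forall>x\<in>K. (\<Sum>i\<in>I. (u i - v i) * (x i - c i)) < e"
proof -
  obtain R where R: "\<And>u i. u \<in> K \<Longrightarrow> i \<in> I \<Longrightarrow> \<bar>u i\<bar> \<le> R"
    using compactin_powertop_real_bounded[OF assms(1-3)] by metis
  define B where "B = real (card I) * (2 * \<bar>R\<bar>)"
  define d where "d = e / (B + 1)"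
  have "B \<ge> 0" by (simp add: B_def)
  then have d: "d > 0" "B * d < e" using assms(4) by (auto simp: d_def field_simps)
  obtain N where N: "finite N" "N \<subseteq> K" "K \<subseteq> (\<Union>v\<in>N. coordinate_ball S I v d)"
    using finite_coordinate_net[OF assms(1-3) d(1)] .
  have small: "(\<Sum>i\<in>I. (u i - v i) * (x i - c i)) < e"
    if "u \<in> coordinate_ball S I v d" "x \<in> K" for u v x
  proof -
    have "(u i - v i) * (x i - c i) \<le> d * (2 * \<bar>R\<bar>)" if "i \<in> I" for i
    proof -
      have "\<bar>u i - v i\<bar> \<le> d" "\<bar>x i - c i\<bar> \<le> 2 * \<bar>R\<bar>"
        using \<open>u \<in> coordinate_ball S I v d\<close> R[OF \<open>x \<in> K\<close> \<open>i \<in> I\<close>] R[OF assms(5) \<open>i \<in> I\<close>] \<open>i \<in> I\<close>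
        by (auto simp: coordinate_ball_def)
      then have "\<bar>u i - v i\<bar> * \<bar>x i - c i\<bar> \<le> d * (2 * \<bar>R\<bar>)" using d(1) by (intro mult_mono) auto
      then show ?thesis by (metis abs_le_D1 abs_mult)
    qed
    then have "(\<Sum>i\<in>I. (u i - v i) * (x i - c i)) \<le> B * d"
      using sum_mono[of I _ "\<lambda>_. d * (2 * \<bar>R\<bar>)"] by (simp add: B_def mult_ac)
    with d(2) show ?thesis by simp
  qed
  have "\<exists>v\<in>N. \<forall>x\<in>K. (\<Sum>i\<in>I. (u i - v i) * (x i - c i)) < e" if "u \<in> K" for u
    using N(3) that small by blast
  then show thesis using that[OF N(1,2)] by blast
qed

locale convex_fibred_surjection =
  compact_surjection "subtopology (powertop_real S) K" Q h
  for S :: "'i set" and K and Q :: "'b topology" and h +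
  assumes convex_fibre:
    "w \<in> topspace Q \<Longrightarrow> convex_family S {u \<in> topspace (subtopology (powertop_real S) K). h u = w}"
begin

abbreviation total_space where "total_space \<equiv> subtopology (powertop_real S) K"

lemma compactin_domain: "compactin (powertop_real S) (topspace total_space)"
  using compact_domain unfolding compact_space_def by (simp add: compactin_subtopology)

lemma descent_neighbourhood:
  assumes "finite I" "I \<subseteq> S" "e > 0" "c \<in> topspace total_space"
    and sup: "\<And>l. continuous_map Q euclideanreal (fibre_Sup total_space h (\<lambda>u. \<Sum>i\<in>I. l i * u i))"
  obtains V where "openin Q V" "h c \<in> V"
    "\<And>u w. u \<in> topspace total_space \<Longrightarrow> w \<in> V \<Longrightarrow>
       \<exists>v\<in>topspace total_space. h v = w \<and> (\<Sum>i\<in>I. (u i - c i) * (v i - c i)) < e"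
proof -
  obtain N where N: "finite N"
    "\<And>u. u \<in> topspace total_space \<Longrightarrow> \<exists>v\<in>N. \<forall>x\<in>topspace total_space. (\<Sum>i\<in>I. (u i - v i) * (x i - c i)) < e / 2"
    by (rule finite_net_of_directions[OF compactin_domain assms(1,2) half_gt_zero[OF assms(3)] assms(4)])
      blast
  define g where "g v u = (\<Sum>i\<in>I. (c i - v i) * u i)" for v u :: "'i \<Rightarrow> real"
  define m where "m v = fibre_Sup total_space h (g v)" for v
  have m: "continuous_map Q euclideanreal (m v)" for v
    unfolding m_def g_def by (rule sup)
  have g: "continuous_map total_space euclideanreal (g v)" for v
    unfolding g_def by (intro continuous_map_from_subtopology continuous_map_linear_functional assms)
  define V where "V = topspace Q \<inter> (\<Inter>v\<in>N. {w \<in> topspace Q. m v w \<in> {m v (h c) - e / 2<..}})"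
  show thesis
  proof
    show "openin Q V"
      unfolding V_def
      by (cases "N = {}") (auto intro!: openin_Int openin_INT N openin_continuous_map_preimage[OF m]
          simp del: greaterThan_iff)
    show "h c \<in> V" using image_in_topspace[OF assms(4)] assms(3) by (auto simp: V_def)
    fix u w assume u: "u \<in> topspace total_space" and w: "w \<in> V"
    obtain v where v: "v \<in> N" "\<forall>x\<in>topspace total_space. (\<Sum>i\<in>I. (u i - v i) * (x i - c i)) < e / 2"
      using N(2)[OF u] ..
    obtain x where x: "x \<in> topspace total_space" "h x = w" "g v x = m v w"
      using fibre_Sup_attained[OF g, of w v] w surjective by (auto simp: V_def m_def)
    have "g v c - e / 2 < g v x"
      using fibre_Sup_upper[OF g assms(4), of v] w v(1) x(3) by (auto simp: V_def m_def)
    moreover have "(\<Sum>i\<in>I. (u i - c i) * (x i - c i)) =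
        (\<Sum>i\<in>I. (u i - v i) * (x i - c i)) - (g v x - g v c)"
      by (simp add: g_def sum_subtractf algebra_simps flip: sum.distrib)
    ultimately have "(\<Sum>i\<in>I. (u i - c i) * (x i - c i)) < e" using v(2) x(1) by fastforce
    with x show "\<exists>v\<in>topspace total_space. h v = w \<and> (\<Sum>i\<in>I. (u i - c i) * (v i - c i)) < e" by blast
  qed
qed

lemma fibre_meets_coordinate_ball:
  assumes "w \<in> topspace Q" "finite I" "I \<subseteq> S" "e > 0"
    and descent: "\<And>u. u \<in> topspace total_space \<Longrightarrow>
      \<exists>v\<in>topspace total_space. h v = w \<and> (\<Sum>i\<in>I. (u i - c i) * (v i - c i)) < e\<^sup>2"
  obtains u where "u \<in> topspace total_space" "h u = w" "u \<in> coordinate_ball S I c e"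
proof -
  define F where "F = {u \<in> topspace total_space. h u = w}"
  have "\<exists>u\<in>F. (\<Sum>i\<in>I. (u i - c i)\<^sup>2) < e\<^sup>2"
  proof (rule compact_convex_family_point_near[OF _ _ _ assms(2,3)])
    show "compactin (powertop_real S) F"
      using compactin_fibre[OF assms(1)] unfolding F_def by (simp add: compactin_subtopology)
    show "F \<noteq> {}" using assms(1) unfolding F_def surjective[symmetric] by blast
    show "convex_family S F" unfolding F_def by (rule convex_fibre[OF assms(1)])
    show "\<exists>v\<in>F. (\<Sum>i\<in>I. (u i - c i) * (v i - c i)) < e\<^sup>2" if "u \<in> F" for u
      using descent[of u] that by (auto simp: F_def)
  qed
  then obtain u where u: "u \<in> topspace total_space" "h u = w" "(\<Sum>i\<in>I. (u i - c i)\<^sup>2) < e\<^sup>2"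
    by (auto simp: F_def)
  have "\<bar>u i - c i\<bar> < e" if "i \<in> I" for i
  proof -
    have "(u i - c i)\<^sup>2 \<le> (\<Sum>i\<in>I. (u i - c i)\<^sup>2)"
      by (rule member_le_sum[OF that]) (use assms(2) in auto)
    then have "\<bar>u i - c i\<bar>\<^sup>2 < e\<^sup>2" using u(3) by simp
    then show ?thesis using assms(4) by (intro power_less_imp_less_base[of _ 2 e]) auto
  qed
  then show thesis using that[OF u(1,2)] u(1) by (auto simp: coordinate_ball_def PiE_iff)
qed

lemma open_map_if_continuous_linear_fibre_Sup:
  assumes "\<And>I l. finite I \<Longrightarrow> I \<subseteq> S \<Longrightarrow>
    continuous_map Q euclideanreal (fibre_Sup total_space h (\<lambda>u. \<Sum>i\<in>I. l i * u i))"
  shows "open_map total_space Q h"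
  unfolding open_map_def
proof (intro allI impI)
  fix W assume W: "openin total_space W"
  have "\<exists>V. openin Q V \<and> h c \<in> V \<and> V \<subseteq> h ` W" if "c \<in> W" for c
  proof -
    obtain T where T: "openin (powertop_real S) T" "W = T \<inter> K" using W by (auto simp: openin_subtopology)
    then obtain I e where I: "finite I" "I \<subseteq> S" "e > 0" "coordinate_ball S I c e \<subseteq> T"
      using openin_powertop_real_contains_coordinate_ball[of S T c] \<open>c \<in> W\<close> by auto
    have c: "c \<in> topspace total_space" using openin_subset[OF W] that by auto
    obtain V where V: "openin Q V" "h c \<in> V"
      and descent: "\<And>u w. u \<in> topspace total_space \<Longrightarrow> w \<in> V \<Longrightarrow>
        \<exists>v\<in>topspace total_space. h v = w \<and> (\<Sum>i\<in>I. (u i - c i) * (v i - c i)) < e\<^sup>2"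
      by (rule descent_neighbourhood[OF I(1,2) zero_less_power[OF I(3)] c assms[OF I(1,2)]]) blast
    have "w \<in> h ` W" if w: "w \<in> V" for w
    proof -
      have "w \<in> topspace Q" using w openin_subset[OF V(1)] by blast
      then obtain u where "u \<in> topspace total_space" "h u = w" "u \<in> coordinate_ball S I c e"
        using fibre_meets_coordinate_ball[OF _ I(1-3) descent[OF _ w]] by blast
      then show ?thesis using I(4) T(2) by auto
    qed
    then show ?thesis using V by blast
  qed
  then show "openin Q (h ` W)" by (subst openin_subopen) blast
qed

end

section \<open>Step functions\<close>

definition step_on :: "real set \<Rightarrow> (real \<Rightarrow> 'c) \<Rightarrow> bool" where
  "step_on S h \<longleftrightarrow> (\<forall>t u. t < u \<and> S \<inter> {t<..u} = {} \<longrightarrow> h t = h u)"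

lemma step_on_mono: "step_on S h \<Longrightarrow> S \<subseteq> T \<Longrightarrow> step_on T h"
  unfolding step_on_def by blast

lemma step_on_const: "step_on S (\<lambda>t. c)"
  by (simp add: step_on_def)

lemma step_on_compose: "step_on S h \<Longrightarrow> step_on S (\<lambda>t. k (h t))"
  unfolding step_on_def by metis

lemma step_on_compose2: "step_on S g \<Longrightarrow> step_on S h \<Longrightarrow> step_on S (\<lambda>t. k (g t) (h t))"
  unfolding step_on_def by metis

lemma step_on_eval: "step_on S G \<Longrightarrow> step_on T \<alpha> \<Longrightarrow> step_on (S \<union> T) (\<lambda>t. G t (\<alpha> t))"
  by (rule step_on_compose2[of _ G \<alpha> "\<lambda>g x. g x"]) (auto elim: step_on_mono)

lemma step_on_if:
  "step_on S p \<Longrightarrow> step_on S g \<Longrightarrow> step_on S h \<Longrightarrow> step_on S (\<lambda>t. if p t then g t else h t)"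
  unfolding step_on_def by metis

lemma step_on_less: "step_on {c} (\<lambda>t. t < c)"
  unfolding step_on_def by force

lemma step_on_Ico: "step_on {a, b} (\<lambda>t. t \<in> {a..<b})"
  unfolding step_on_def by force

lemma step_on_cell:
  assumes "step_on S h" "S \<inter> {a<..<b} = {}" "t \<in> {a..<b}"
  shows "h t = h a"
proof (cases "t = a")
  case False
  then have "a < t" "S \<inter> {a<..t} = {}" using assms(2,3) by force+
  then show ?thesis using assms(1) unfolding step_on_def by metis
qed simp

lemma breakpoint_induct [consumes 2, case_names cell join]:
  fixes a b :: real
  assumes "finite S" "a < b"
    and cell: "\<And>a b. a < b \<Longrightarrow> S \<inter> {a<..<b} = {} \<Longrightarrow> P a b"
    and join: "\<And>a c b. a < c \<Longrightarrow> c < b \<Longrightarrow> P a c \<Longrightarrow> P c b \<Longrightarrow> P a b"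
  shows "P a b"
  using \<open>a < b\<close>
proof (induction "card (S \<inter> {a<..<b})" arbitrary: a b rule: less_induct)
  case less
  show ?case
  proof (cases "S \<inter> {a<..<b} = {}")
    case True
    then show ?thesis using cell less.prems by blast
  next
    case False
    then obtain c where c: "c \<in> S" "a < c" "c < b" by auto
    have "S \<inter> {a<..<c} \<subset> S \<inter> {a<..<b}" "S \<inter> {c<..<b} \<subset> S \<inter> {a<..<b}"
      using c by auto
    then have "card (S \<inter> {a<..<c}) < card (S \<inter> {a<..<b})"
      "card (S \<inter> {c<..<b}) < card (S \<inter> {a<..<b})"
      using \<open>finite S\<close> by (auto intro!: psubset_card_mono)
    then show ?thesis using less.hyps c join by blast
  qed
qed

lemma step_on_if_constant_on_cells:
  fixes ts :: "nat \<Rightarrow> real"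
  assumes cells: "\<And>i t. i < n \<Longrightarrow> t \<in> {ts i..<ts (Suc i)} \<Longrightarrow> h t = h (ts i)"
    and outside: "\<And>t. t \<notin> {ts 0..<ts n} \<Longrightarrow> h t = c"
  shows "step_on (ts ` {..n}) h"
  unfolding step_on_def
proof (intro allI impI, elim conjE)
  fix t u :: real
  assume "t < u" "ts ` {..n} \<inter> {t<..u} = {}"
  then have skip: "ts i \<le> t \<or> u < ts i" if "i \<le> n" for i using that by force
  show "h t = h u"
  proof (cases "t \<in> {ts 0..<ts n}")
    case False
    then have "u \<notin> {ts 0..<ts n}" using skip[of 0] skip[of n] \<open>t < u\<close> by auto
    with False show ?thesis using outside by metis
  next
    case True
    then obtain k where k: "k < n" "ts k \<le> t" "t < ts (Suc k)"
      using ex_least_nat_less[of "\<lambda>i. t < ts i" n] by (auto simp: not_less)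
    then have "u < ts (Suc k)" using skip[of "Suc k"] by simp
    then have "t \<in> {ts k..<ts (Suc k)}" "u \<in> {ts k..<ts (Suc k)}" using k \<open>t < u\<close> by auto
    then show ?thesis using cells[OF k(1)] by metis
  qed
qed

lemma step_on_imp_constant_on_cells:
  fixes a b :: real
  assumes "finite S" "step_on S h" "a < b"
  obtains n ts where "ts 0 = a" "ts n = b" "\<And>i. i < n \<Longrightarrow> ts i < ts (Suc i)"
    "\<And>i t. i < n \<Longrightarrow> t \<in> {ts i..<ts (Suc i)} \<Longrightarrow> h t = h (ts i)"
proof -
  define xs where "xs = a # sorted_list_of_set (S \<inter> {a<..<b}) @ [b]"
  have set: "set xs = insert a (insert b (S \<inter> {a<..<b}))" using assms(1) by (auto simp: xs_def)
  have "sorted_wrt (<) xs"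
    using assms(1,3) by (auto simp: xs_def sorted_wrt_append)
  then have less: "xs ! i < xs ! j" if "i < j" "j < length xs" for i j
    using sorted_wrt_nth_less that by blast
  show thesis
  proof (rule that[of "\<lambda>i. xs ! i" "length xs - 1"])
    show "xs ! 0 = a" "xs ! (length xs - 1) = b" by (simp_all add: xs_def nth_append)
  next
    fix i assume "i < length xs - 1"
    then have i: "i < length xs" "Suc i < length xs" by auto
    then show "xs ! i < xs ! Suc i" by (simp add: less)
    have "S \<inter> {xs ! i<..<xs ! Suc i} = {}"
    proof (rule ccontr)
      assume "S \<inter> {xs ! i<..<xs ! Suc i} \<noteq> {}"
      then obtain x where x: "x \<in> S" "xs ! i < x" "x < xs ! Suc i" by auto
      have "xs ! i \<in> {a..b}" "xs ! Suc i \<in> {a..b}"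
        using i set assms(3) nth_mem[of i xs] nth_mem[of "Suc i" xs] by auto
      then have "x \<in> set xs" using x set by auto
      then obtain j where "j < length xs" "x = xs ! j" by (auto simp: in_set_conv_nth)
      then show False
        using x less[of j i] less[of "Suc i" j] i
        by (metis less_Suc_eq linorder_neqE_nat not_less_iff_gr_or_eq)
    qed
    then show "h t = h (xs ! i)" if "t \<in> {xs ! i..<xs ! Suc i}" for t
      using step_on_cell assms(2) that by blast
  qed
qed

lemma has_integral_const_Ioo:
  fixes h :: "real \<Rightarrow> real"
  assumes "a \<le> b" "\<And>t. a < t \<Longrightarrow> t < b \<Longrightarrow> h t = c"
  shows "(h has_integral (b - a) * c) {a..b}"
  using has_integral_spike_interior[of "\<lambda>_. c" "(b - a) * c" a b h] has_integral_const_real[of c a b]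
    assms by simp

lemma step_on_integrable:
  fixes h :: "real \<Rightarrow> real"
  assumes "finite S" "step_on S h"
  shows "h integrable_on {a..b}"
proof (cases "a < b")
  case True
  with assms(1) show ?thesis
  proof (induction rule: breakpoint_induct)
    case (cell a b)
    then have "(h has_integral (b - a) * h a) {a..b}"
      by (intro has_integral_const_Ioo step_on_cell[OF assms(2)]) auto
    then show ?case by (rule has_integral_integrable)
  next
    case (join a c b)
    then show ?case by (meson Henstock_Kurzweil_Integration.integrable_combine less_imp_le)
  qed
next
  case False
  then have "(h has_integral 0) {a..b}" by (intro has_integral_null_real) simp
  then show ?thesis by (rule has_integral_integrable)
qed

lemma integral_cong_Ioo:
  fixes g h :: "real \<Rightarrow> real"
  assumes "\<And>t. a < t \<Longrightarrow> t < b \<Longrightarrow> g t = h t"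
  shows "integral {a..b} g = integral {a..b} h"
  unfolding integral_open_interval_real by (rule integral_cong) (use assms in auto)

definition equidistributed :: "real set \<Rightarrow> real \<Rightarrow> real \<Rightarrow> real \<Rightarrow> (real \<Rightarrow> bool) \<Rightarrow> bool" where
  "equidistributed S a b \<tau> \<kappa> \<longleftrightarrow> (\<forall>h::real \<Rightarrow> real. step_on S h \<longrightarrow>
     integral {a..b} (\<lambda>t. if \<kappa> t then h t else 0) = \<tau> * integral {a..b} h)"

lemma equidistributed_cell:
  fixes \<tau> :: real
  assumes "0 \<le> \<tau>" "\<tau> \<le> 1" "a < b" "S \<inter> {a<..<b} = {}"
  shows "equidistributed S a b \<tau> (\<lambda>t. t < a + \<tau> * (b - a))"
  unfolding equidistributed_def
proof (intro allI impI)
  fix h :: "real \<Rightarrow> real"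
  assume "step_on S h"
  then have const: "h t = h a" if "a < t" "t < b" for t
    using step_on_cell assms(4) that by (metis atLeastLessThan_iff less_imp_le)
  define e where "e = a + \<tau> * (b - a)"
  have "0 \<le> \<tau> * (b - a)" "\<tau> * (b - a) \<le> b - a"
    using mult_left_le_one_le[of "b - a" \<tau>] assms(1-3) by auto
  then have e: "a \<le> e" "e \<le> b" by (auto simp: e_def)
  have "((\<lambda>t. if t < e then h t else 0) has_integral (e - a) * h a) {a..e}"
    "((\<lambda>t. if t < e then h t else 0) has_integral (b - e) * 0) {e..b}"
    by (rule has_integral_const_Ioo; use e const in auto)+
  then have "((\<lambda>t. if t < e then h t else 0) has_integral (e - a) * h a + (b - e) * 0) {a..b}"
    by (rule has_integral_combine[OF e])
  moreover have "(h has_integral (b - a) * h a) {a..b}"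
    by (rule has_integral_const_Ioo) (use assms const in auto)
  ultimately show "integral {a..b} (\<lambda>t. if t < a + \<tau> * (b - a) then h t else 0) = \<tau> * integral {a..b} h"
    by (simp add: integral_unique e_def)
qed

lemma equidistributed_join:
  assumes "finite S" "finite T" "step_on T \<kappa>" "a \<le> c" "c \<le> b"
    and "equidistributed S a c \<tau> \<kappa>" "equidistributed S c b \<tau> \<kappa>"
  shows "equidistributed S a b \<tau> \<kappa>"
  unfolding equidistributed_def
proof (intro allI impI)
  fix h :: "real \<Rightarrow> real"
  assume h: "step_on S h"
  have "step_on (S \<union> T) (\<lambda>t. if \<kappa> t then h t else 0)"
    by (intro step_on_if step_on_const step_on_mono[OF assms(3)] step_on_mono[OF h]) auto
  then have "(\<lambda>t. if \<kappa> t then h t else 0) integrable_on {a..b}" "h integrable_on {a..b}"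
    using step_on_integrable[of "S \<union> T"] step_on_integrable[of S h] assms(1,2) h by blast+
  note combine = this[THEN Henstock_Kurzweil_Integration.integral_combine[OF assms(4,5)], symmetric]
  show "integral {a..b} (\<lambda>t. if \<kappa> t then h t else 0) = \<tau> * integral {a..b} h"
    using assms(6,7) h unfolding equidistributed_def by (simp add: combine distrib_left)
qed

lemma equidistributed_cong:
  assumes "equidistributed S a b \<tau> \<kappa>" "\<And>t. a < t \<Longrightarrow> t < b \<Longrightarrow> \<kappa> t = \<kappa>' t"
  shows "equidistributed S a b \<tau> \<kappa>'"
proof -
  have "integral {a..b} (\<lambda>t. if \<kappa>' t then h t else 0) = integral {a..b} (\<lambda>t. if \<kappa> t then h t else 0)"
    for h :: "real \<Rightarrow> real"
    by (rule integral_cong_Ioo) (simp add: assms(2))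
  then show ?thesis using assms(1) unfolding equidistributed_def by simp
qed

lemma equidistributed_exists:
  fixes \<tau> :: real
  assumes "finite S" "a < b" "0 \<le> \<tau>" "\<tau> \<le> 1"
  shows "\<exists>\<kappa> T. finite T \<and> step_on T \<kappa> \<and> equidistributed S a b \<tau> \<kappa>"
  using assms(1,2)
proof (induction rule: breakpoint_induct)
  case (cell a b)
  then show ?case
    using equidistributed_cell[OF assms(3,4)] step_on_less finite.emptyI finite.insertI by meson
next
  case (join a c b)
  then obtain \<kappa>\<^sub>1 T\<^sub>1 \<kappa>\<^sub>2 T\<^sub>2 where left: "finite T\<^sub>1" "step_on T\<^sub>1 \<kappa>\<^sub>1" "equidistributed S a c \<tau> \<kappa>\<^sub>1"
    and right: "finite T\<^sub>2" "step_on T\<^sub>2 \<kappa>\<^sub>2" "equidistributed S c b \<tau> \<kappa>\<^sub>2"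
    by blast
  define \<kappa> where "\<kappa> = (\<lambda>t. if t < c then \<kappa>\<^sub>1 t else \<kappa>\<^sub>2 t)"
  define T where "T = insert c (T\<^sub>1 \<union> T\<^sub>2)"
  have "finite T" using left right by (simp add: T_def)
  have "step_on T \<kappa>"
    unfolding \<kappa>_def
    by (intro step_on_if step_on_mono[OF step_on_less] step_on_mono[OF left(2)] step_on_mono[OF right(2)])
      (auto simp: T_def)
  have "equidistributed S a c \<tau> \<kappa>"
    by (rule equidistributed_cong[OF left(3)]) (simp add: \<kappa>_def)
  moreover have "equidistributed S c b \<tau> \<kappa>"
    by (rule equidistributed_cong[OF right(3)]) (simp add: \<kappa>_def)
  ultimately have "equidistributed S a b \<tau> \<kappa>"
    using equidistributed_join[OF assms(1) \<open>finite T\<close> \<open>step_on T \<kappa>\<close>, of a c b] join(1,2) by simp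
  with \<open>finite T\<close> \<open>step_on T \<kappa>\<close> show ?case by blast
qed

section \<open>Integrals along paths in $HM(X)$\<close>

lemma HM_iff_step_on:
  "\<alpha> \<in> HM X \<longleftrightarrow> (\<forall>t\<in>{0..<1}. \<alpha> t \<in> topspace X) \<and> (\<forall>t. t \<notin> {0..<1} \<longrightarrow> \<alpha> t = undefined) \<and>
     (\<exists>S. finite S \<and> step_on S \<alpha>)" (is "_ \<longleftrightarrow> ?step")
proof
  assume "\<alpha> \<in> HM X"
  then obtain n ts where \<alpha>: "\<forall>t\<in>{0..<1}. \<alpha> t \<in> topspace X" "\<forall>t. t \<notin> {0..<1} \<longrightarrow> \<alpha> t = undefined"
    and ts: "ts 0 = 0" "ts n = 1" "\<forall>i<n. \<forall>t\<in>{ts i..<ts (Suc i)}. \<alpha> t = \<alpha> (ts i)"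
    unfolding HM_def by auto
  have "step_on (ts ` {..n}) \<alpha>"
    by (rule step_on_if_constant_on_cells[where c = undefined]) (use ts \<alpha>(2) in metis)+
  then show ?step using \<alpha> by blast
next
  assume ?step
  then obtain S where \<alpha>: "\<forall>t\<in>{0..<1}. \<alpha> t \<in> topspace X" "\<forall>t. t \<notin> {0..<1} \<longrightarrow> \<alpha> t = undefined"
    and S: "finite S" "step_on S \<alpha>"
    by blast
  from S obtain n ts where "ts 0 = 0" "ts n = 1" "\<And>i. i < n \<Longrightarrow> ts i < ts (Suc i)"
    "\<And>i t. i < n \<Longrightarrow> t \<in> {ts i..<ts (Suc i)} \<Longrightarrow> \<alpha> t = \<alpha> (ts i)"
    by (rule step_on_imp_constant_on_cells[OF _ _ zero_less_one]) blast
  with \<alpha> show "\<alpha> \<in> HM X" unfolding HM_def by blast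
qed

lemma HM_in_topspace: "\<alpha> \<in> HM X \<Longrightarrow> t \<in> {0..<1} \<Longrightarrow> \<alpha> t \<in> topspace X"
  by (simp add: HM_iff_step_on)

lemma HM_undefined: "\<alpha> \<in> HM X \<Longrightarrow> t \<notin> {0..<1} \<Longrightarrow> \<alpha> t = undefined"
  by (simp add: HM_iff_step_on)

lemma HM_breakpoints:
  assumes "\<alpha> \<in> HM X"
  obtains S where "finite S" "step_on S \<alpha>"
  using assms by (auto simp: HM_iff_step_on)

lemma restrict_in_HM:
  assumes "finite S" "step_on S h" "\<And>t. t \<in> {0..<1} \<Longrightarrow> h t \<in> topspace X"
  shows "restrict h {0..<1} \<in> HM X"
proof -
  have "step_on (S \<union> {0, 1}) (restrict h {0..<1})"
    unfolding restrict_def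
    by (intro step_on_if step_on_const step_on_mono[OF assms(2)] step_on_mono[OF step_on_Ico]) auto
  then show ?thesis using assms by (auto simp: HM_iff_step_on intro!: exI[of _ "S \<union> {0, 1}"])
qed

definition path_integral :: "(real \<Rightarrow> 'a \<Rightarrow> real) \<Rightarrow> real \<Rightarrow> real \<Rightarrow> (real \<Rightarrow> 'a) \<Rightarrow> real" where
  "path_integral G a b \<alpha> = integral {a..b} (\<lambda>t. G t (\<alpha> t))"

definition step_integrand :: "'a topology \<Rightarrow> real set \<Rightarrow> (real \<Rightarrow> 'a \<Rightarrow> real) \<Rightarrow> bool" where
  "step_integrand X S G \<longleftrightarrow>
     finite S \<and> step_on S G \<and> (\<forall>t. continuous_map X euclideanreal (G t))"

lemma integrable_along_path:
  fixes G :: "real \<Rightarrow> 'a \<Rightarrow> real"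
  assumes "finite S" "step_on S G" "\<alpha> \<in> HM X"
  shows "(\<lambda>t. G t (\<alpha> t)) integrable_on {a..b}"
proof -
  obtain T where T: "finite T" "step_on T \<alpha>" using HM_breakpoints[OF assms(3)] .
  show ?thesis
    by (rule step_on_integrable[OF _ step_on_eval[OF assms(2) T(2)]]) (use T(1) assms(1) in simp)
qed

lemma path_integral_cong:
  "(\<And>t. a < t \<Longrightarrow> t < b \<Longrightarrow> G t (\<alpha> t) = H t (\<beta> t)) \<Longrightarrow> path_integral G a b \<alpha> = path_integral H a b \<beta>"
  unfolding path_integral_def by (rule integral_cong_Ioo)

lemma path_integral_combine:
  assumes "finite S" "step_on S G" "\<alpha> \<in> HM X" "a \<le> c" "c \<le> b"
  shows "path_integral G a b \<alpha> = path_integral G a c \<alpha> + path_integral G c b \<alpha>"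
  unfolding path_integral_def
  using Henstock_Kurzweil_Integration.integral_combine[OF assms(4,5) integrable_along_path[OF assms(1-3)]] by simp

lemma path_integral_mono:
  assumes "finite S" "step_on S G" "\<alpha> \<in> HM X" "finite T" "step_on T H" "\<beta> \<in> HM Y"
    and "\<And>t. a < t \<Longrightarrow> t < b \<Longrightarrow> G t (\<alpha> t) \<le> H t (\<beta> t)"
  shows "path_integral G a b \<alpha> \<le> path_integral H a b \<beta>"
  unfolding path_integral_def integral_open_interval_real
  using integrable_along_path[OF assms(1-3)] integrable_along_path[OF assms(4-6)] assms(7)
  by (intro integral_le) (auto simp: integrable_on_Icc_iff_Ioo)

lemma path_integral_sum:
  assumes "finite I" "finite S" "\<And>s. s \<in> I \<Longrightarrow> step_on S (G s)" "\<alpha> \<in> HM X"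
  shows "path_integral (\<lambda>t x. \<Sum>s\<in>I. l s * G s t x) a b \<alpha> = (\<Sum>s\<in>I. l s * path_integral (G s) a b \<alpha>)"
proof -
  have "(\<lambda>t. l s * G s t (\<alpha> t)) integrable_on {a..b}" if "s \<in> I" for s
    using integrable_along_path[OF assms(2) assms(3)[OF that] assms(4)] by (rule integrable_on_mult_right)
  then show ?thesis unfolding path_integral_def using assms(1) by (simp add: integral_sum)
qed

lemma HM_fun_eq_path_integral:
  "\<alpha> \<in> HM X \<Longrightarrow> HM_fun X \<phi> a b \<alpha> = path_integral (\<lambda>t. \<phi>) a b \<alpha> / (b - a)"
  by (simp add: HM_fun_def path_integral_def)

lemma HM_fun_in_SHM:
  "continuous_map X euclideanreal \<phi> \<Longrightarrow> 0 \<le> a \<Longrightarrow> a < b \<Longrightarrow> b \<le> 1 \<Longrightarrow> HM_fun X \<phi> a b \<in> SHM X"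
  unfolding SHM_def by blast

lemma SHM_cases:
  assumes "s \<in> SHM X"
  obtains \<phi> a b where "s = HM_fun X \<phi> a b" "continuous_map X euclideanreal \<phi>" "0 \<le> a" "a < b" "b \<le> 1"
  using assms unfolding SHM_def by blast

lemma HM_fun_le_add:
  assumes "\<alpha> \<in> HM X" "0 \<le> a" "a < b" "b \<le> 1" "\<And>x. x \<in> topspace X \<Longrightarrow> \<phi> x \<le> \<psi> x + c"
  shows "HM_fun X \<phi> a b \<alpha> \<le> HM_fun X \<psi> a b \<alpha> + c"
proof -
  have "path_integral (\<lambda>t. \<phi>) a b \<alpha> \<le> path_integral (\<lambda>t x. \<psi> x + c) a b \<alpha>"
    by (rule path_integral_mono[OF finite.emptyI step_on_const assms(1) finite.emptyI step_on_const assms(1)])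
      (use assms in \<open>auto intro!: assms(5) HM_in_topspace[OF assms(1)]\<close>)
  also have "\<dots> = path_integral (\<lambda>t. \<psi>) a b \<alpha> + (b - a) * c"
    unfolding path_integral_def
    using integrable_along_path[OF finite.emptyI step_on_const assms(1)] assms(3)
    by (subst Henstock_Kurzweil_Integration.integral_add) auto
  finally have "path_integral (\<lambda>t. \<phi>) a b \<alpha> / (b - a) \<le>
      (path_integral (\<lambda>t. \<psi>) a b \<alpha> + (b - a) * c) / (b - a)"
    using assms(3) by (intro divide_right_mono) auto
  then show ?thesis
    using assms(1,3) by (simp add: HM_fun_eq_path_integral add_divide_distrib)
qed

definition HM_const :: "'a \<Rightarrow> real \<Rightarrow> 'a" where
  "HM_const x = (\<lambda>t\<in>{0..<1}. x)"

lemma HM_const_in_HM: "x \<in> topspace X \<Longrightarrow> HM_const x \<in> HM X"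
  unfolding HM_const_def by (rule restrict_in_HM[OF finite.emptyI step_on_const])

lemma HM_fun_HM_const:
  assumes "x \<in> topspace X" "0 \<le> a" "a < b" "b \<le> 1"
  shows "HM_fun X \<phi> a b (HM_const x) = \<phi> x"
proof -
  have "((\<lambda>t. \<phi> (HM_const x t)) has_integral (b - a) * \<phi> x) {a..b}"
    by (rule has_integral_const_Ioo) (use assms in \<open>auto simp: HM_const_def\<close>)
  then show ?thesis
    using assms by (simp add: HM_fun_eq_path_integral HM_const_in_HM path_integral_def integral_unique)
qed

lemma SHM_in_Hcoord_range:
  assumes "compact_space X" "s \<in> SHM X" "\<alpha> \<in> HM X"
  shows "s \<alpha> \<in> Hcoord_range X s"
proof -
  define \<phi> where "\<phi> = (SOME \<phi>. \<exists>a b. continuous_map X euclideanreal \<phi> \<and> 0 \<le> a \<and> a < b \<and> b \<le> 1 \<and>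
                          s = HM_fun X \<phi> a b)"
  have "\<exists>\<phi> a b. continuous_map X euclideanreal \<phi> \<and> 0 \<le> a \<and> a < b \<and> b \<le> 1 \<and> s = HM_fun X \<phi> a b"
    using assms(2) by (auto simp: SHM_def)
  from someI_ex[OF this, folded \<phi>_def] obtain a b where \<phi>: "continuous_map X euclideanreal \<phi>"
    and ab: "0 \<le> a" "a < b" "b \<le> 1" and s: "s = HM_fun X \<phi> a b"
    by blast
  have "compact (\<phi> ` topspace X)"
    using assms(1) \<phi> image_compactin by (fastforce simp: compact_space_def)
  then have "bdd_above (\<phi> ` topspace X)" "bdd_below (\<phi> ` topspace X)"
    by (auto simp: compact_imp_bounded bounded_imp_bdd_above bounded_imp_bdd_below)
  then have bounds: "Inf (\<phi> ` topspace X) \<le> \<phi> x" "\<phi> x \<le> Sup (\<phi> ` topspace X)" if "x \<in> topspace X" for x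
    using that by (auto intro: cInf_lower cSup_upper)
  have "HM_fun X (\<lambda>x. 0) a b \<alpha> = 0" using assms(3) by (simp add: HM_fun_def)
  moreover have "HM_fun X (\<lambda>x. 0) a b \<alpha> \<le> s \<alpha> + - Inf (\<phi> ` topspace X)"
    unfolding s by (rule HM_fun_le_add[OF assms(3) ab]) (use bounds in auto)
  moreover have "s \<alpha> \<le> HM_fun X (\<lambda>x. 0) a b \<alpha> + Sup (\<phi> ` topspace X)"
    unfolding s by (rule HM_fun_le_add[OF assms(3) ab]) (use bounds in auto)
  ultimately show ?thesis
    unfolding Hcoord_range_def Let_def \<phi>_def[symmetric] by simp
qed

lemma SHM_representation:
  assumes "s \<in> SHM X"
  obtains S G where "step_integrand X S G" "\<And>\<alpha>. \<alpha> \<in> HM X \<Longrightarrow> s \<alpha> = path_integral G 0 1 \<alpha>"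
proof -
  obtain \<phi> a b where s: "s = HM_fun X \<phi> a b" "continuous_map X euclideanreal \<phi>" "0 \<le> a" "a < b" "b \<le> 1"
    using SHM_cases[OF assms] .
  define G where "G = (\<lambda>t x. if t \<in> {a..<b} then \<phi> x / (b - a) else 0)"
  show thesis
  proof (rule that[of "{a, b}" G])
    have "step_on {a, b} G"
      unfolding G_def by (rule step_on_compose[OF step_on_Ico])
    moreover have "continuous_map X euclideanreal (G t)" for t
      using continuous_map_real_mult_right[OF s(2), of "1 / (b - a)"]
      by (cases "t \<in> {a..<b}") (simp_all add: G_def)
    ultimately show "step_integrand X {a, b} G" by (simp add: step_integrand_def)
    fix \<alpha> assume "\<alpha> \<in> HM X"
    have "path_integral G 0 1 \<alpha> = integral ({a..<b} \<inter> {0..1}) (\<lambda>t. \<phi> (\<alpha> t) / (b - a))"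
      unfolding path_integral_def G_def by (rule integral_restrict_Int)
    also have "\<dots> = integral {a..b} (\<lambda>t. \<phi> (\<alpha> t) / (b - a))"
      by (rule integral_spike_set; rule negligible_subset[of "{b}"]) (use s in auto)
    also have "\<dots> = s \<alpha>"
      using \<open>\<alpha> \<in> HM X\<close> by (simp add: s(1) HM_fun_eq_path_integral path_integral_def)
    finally show "s \<alpha> = path_integral G 0 1 \<alpha>" by simp
  qed
qed

lemma SHM_family_representation:
  assumes "finite I" "I \<subseteq> SHM X"
  obtains S G where "finite S" "\<And>s. s \<in> I \<Longrightarrow> step_integrand X S (G s)"
    "\<And>s \<alpha>. s \<in> I \<Longrightarrow> \<alpha> \<in> HM X \<Longrightarrow> s \<alpha> = path_integral (G s) 0 1 \<alpha>"
proof -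
  have "\<exists>S G. step_integrand X S G \<and> (\<forall>\<alpha>\<in>HM X. s \<alpha> = path_integral G 0 1 \<alpha>)" if "s \<in> I" for s
    using SHM_representation[of s X] assms(2) that by (metis subsetD)
  then obtain S G where SG: "\<And>s. s \<in> I \<Longrightarrow> step_integrand X (S s) (G s)"
    "\<And>s \<alpha>. s \<in> I \<Longrightarrow> \<alpha> \<in> HM X \<Longrightarrow> s \<alpha> = path_integral (G s) 0 1 \<alpha>"
    by metis
  show thesis
  proof (rule that[of "\<Union> (S ` I)" G])
    show "finite (\<Union> (S ` I))" using assms(1) SG(1) by (auto simp: step_integrand_def)
    then show "step_integrand X (\<Union> (S ` I)) (G s)" if "s \<in> I" for s
      using SG(1)[OF that] that unfolding step_integrand_def by (auto elim: step_on_mono)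
  qed (rule SG(2))
qed

lemma step_integrand_sum:
  assumes "finite I" "finite S" "\<And>s. s \<in> I \<Longrightarrow> step_integrand X S (G s)"
  shows "step_integrand X S (\<lambda>t x. \<Sum>s\<in>I. l s * G s t x)"
  unfolding step_integrand_def
proof (intro conjI allI)
  show "step_on S (\<lambda>t x. \<Sum>s\<in>I. l s * G s t x)"
    unfolding step_on_def
  proof (intro allI impI ext)
    fix t u x assume "t < u \<and> S \<inter> {t<..u} = {}"
    then have "G s t = G s u" if "s \<in> I" for s
      using assms(3)[OF that] unfolding step_integrand_def step_on_def by blast
    then show "(\<Sum>s\<in>I. l s * G s t x) = (\<Sum>s\<in>I. l s * G s u x)" by simp
  qed
  show "continuous_map X euclideanreal (\<lambda>x. \<Sum>s\<in>I. l s * G s t x)" for t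
    using assms by (intro continuous_map_sum continuous_map_real_mult_left) (auto simp: step_integrand_def)
qed (rule assms(2))

lemma SHM_linear_representation:
  assumes "finite I" "I \<subseteq> SHM X"
  obtains S G where "step_integrand X S G"
    "\<And>\<alpha>. \<alpha> \<in> HM X \<Longrightarrow> (\<Sum>s\<in>I. l s * s \<alpha>) = path_integral G 0 1 \<alpha>"
proof -
  obtain S G where S: "finite S" and G: "\<And>s. s \<in> I \<Longrightarrow> step_integrand X S (G s)"
    "\<And>s \<alpha>. s \<in> I \<Longrightarrow> \<alpha> \<in> HM X \<Longrightarrow> s \<alpha> = path_integral (G s) 0 1 \<alpha>"
    by (rule SHM_family_representation[OF assms]) blast
  show thesis
  proof (rule that[OF step_integrand_sum[OF assms(1) S G(1)]])
    fix \<alpha> assume \<alpha>: "\<alpha> \<in> HM X"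
    have "(\<Sum>s\<in>I. l s * s \<alpha>) = (\<Sum>s\<in>I. l s * path_integral (G s) 0 1 \<alpha>)"
      using G(2)[OF _ \<alpha>] by (intro sum.cong) auto
    also have "\<dots> = path_integral (\<lambda>t x. \<Sum>s\<in>I. l s * G s t x) 0 1 \<alpha>"
      using G(1) by (intro path_integral_sum[OF assms(1) S _ \<alpha>, symmetric]) (simp add: step_integrand_def)
    finally show "(\<Sum>s\<in>I. l s * s \<alpha>) = path_integral (\<lambda>t x. \<Sum>s\<in>I. l s * G s t x) 0 1 \<alpha>" .
  qed
qed

lemma HM_if:
  assumes "finite U" "step_on U \<kappa>" "\<alpha> \<in> HM X" "\<beta> \<in> HM X"
  shows "(\<lambda>t. if \<kappa> t then \<beta> t else \<alpha> t) \<in> HM X"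
proof -
  obtain A where A: "finite A" "step_on A \<alpha>" using HM_breakpoints[OF assms(3)] .
  obtain B where B: "finite B" "step_on B \<beta>" using HM_breakpoints[OF assms(4)] .
  have "step_on (U \<union> A \<union> B) (\<lambda>t. if \<kappa> t then \<beta> t else \<alpha> t)"
    by (intro step_on_if step_on_mono[OF assms(2)] step_on_mono[OF A(2)] step_on_mono[OF B(2)]) auto
  then show ?thesis
    using assms A B by (auto simp: HM_iff_step_on intro!: exI[of _ "U \<union> A \<union> B"])
qed

lemma HM_mixture:
  assumes "finite S" "\<alpha> \<in> HM X" "\<beta> \<in> HM X" "0 \<le> \<tau>" "\<tau> \<le> 1"
  obtains \<gamma> where "\<gamma> \<in> HM X"
    "\<And>G. step_on S G \<Longrightarrow>
       path_integral G 0 1 \<gamma> = (1 - \<tau>) * path_integral G 0 1 \<alpha> + \<tau> * path_integral G 0 1 \<beta>"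
proof -
  obtain A where A: "finite A" "step_on A \<alpha>" using HM_breakpoints[OF assms(2)] .
  obtain B where B: "finite B" "step_on B \<beta>" using HM_breakpoints[OF assms(3)] .
  have fin: "finite (S \<union> A \<union> B)" using assms(1) A B by simp
  then obtain \<kappa> U where U: "finite U" "step_on U \<kappa>" and \<kappa>: "equidistributed (S \<union> A \<union> B) 0 1 \<tau> \<kappa>"
    using equidistributed_exists[OF fin _ assms(4,5), of 0 1] by auto
  define \<gamma> where "\<gamma> = (\<lambda>t. if \<kappa> t then \<beta> t else \<alpha> t)"
  have \<gamma>: "\<gamma> \<in> HM X" unfolding \<gamma>_def by (rule HM_if[OF U assms(2,3)])
  show thesis
  proof (rule that[OF \<gamma>])
    fix G :: "real \<Rightarrow> 'a \<Rightarrow> real" assume G: "step_on S G"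
    note along_\<alpha> = integrable_along_path[OF assms(1) G assms(2), of 0 1]
      and along_\<beta> = integrable_along_path[OF assms(1) G assms(3), of 0 1]
      and along_\<gamma> = integrable_along_path[OF assms(1) G \<gamma>, of 0 1]
    have "path_integral G 0 1 \<gamma> - path_integral G 0 1 \<alpha> = integral {0..1} (\<lambda>t. G t (\<gamma> t) - G t (\<alpha> t))"
      unfolding path_integral_def
      by (rule Henstock_Kurzweil_Integration.integral_diff[OF along_\<gamma> along_\<alpha>, symmetric])
    also have "\<dots> = integral {0..1} (\<lambda>t. if \<kappa> t then G t (\<beta> t) - G t (\<alpha> t) else 0)"
      by (rule integral_cong) (simp add: \<gamma>_def)
    also have "\<dots> = \<tau> * integral {0..1} (\<lambda>t. G t (\<beta> t) - G t (\<alpha> t))"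
    proof -
      have "step_on (S \<union> A \<union> B) (\<lambda>t. G t (\<beta> t) - G t (\<alpha> t))"
        by (rule step_on_compose2; rule step_on_mono[OF step_on_eval[OF G]]) (use A B in auto)
      then show ?thesis using \<kappa> unfolding equidistributed_def by blast
    qed
    also have "integral {0..1} (\<lambda>t. G t (\<beta> t) - G t (\<alpha> t)) = path_integral G 0 1 \<beta> - path_integral G 0 1 \<alpha>"
      unfolding path_integral_def by (rule Henstock_Kurzweil_Integration.integral_diff[OF along_\<beta> along_\<alpha>])
    finally show "path_integral G 0 1 \<gamma> = (1 - \<tau>) * path_integral G 0 1 \<alpha> + \<tau> * path_integral G 0 1 \<beta>"
      by (simp add: algebra_simps)
  qed
qed

lemma SHM_mixture:
  assumes "finite I" "I \<subseteq> SHM X" "\<alpha> \<in> HM X" "\<beta> \<in> HM X" "0 \<le> \<tau>" "\<tau> \<le> 1"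
  obtains \<gamma> where "\<gamma> \<in> HM X" "\<And>s. s \<in> I \<Longrightarrow> s \<gamma> = (1 - \<tau>) * s \<alpha> + \<tau> * s \<beta>"
proof -
  obtain S G where S: "finite S" and G: "\<And>s. s \<in> I \<Longrightarrow> step_integrand X S (G s)"
    "\<And>s \<alpha>. s \<in> I \<Longrightarrow> \<alpha> \<in> HM X \<Longrightarrow> s \<alpha> = path_integral (G s) 0 1 \<alpha>"
    by (rule SHM_family_representation[OF assms(1,2)]) blast
  obtain \<gamma> where \<gamma>: "\<gamma> \<in> HM X" "\<And>G. step_on S G \<Longrightarrow>
      path_integral G 0 1 \<gamma> = (1 - \<tau>) * path_integral G 0 1 \<alpha> + \<tau> * path_integral G 0 1 \<beta>"
    using HM_mixture[OF S assms(3-6)] by auto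
  have "s \<gamma> = (1 - \<tau>) * s \<alpha> + \<tau> * s \<beta>" if s: "s \<in> I" for s
    using \<gamma> G(1)[OF s] by (simp add: G(2)[OF s] assms(3,4) step_integrand_def)
  with \<gamma>(1) show thesis by (rule that)
qed

section \<open>The compact convex space $HX$\<close>

lemma Hembed_apply: "s \<in> SHM X \<Longrightarrow> Hembed X \<alpha> s = s \<alpha>"
  by (simp add: Hembed_def)

lemma Hembed_extensional: "Hembed X \<alpha> \<in> extensional (SHM X)"
  by (simp add: Hembed_def)

lemma Hausdorff_space_HX: "Hausdorff_space (HX X)"
  unfolding HX_def Hprod_def
  by (intro Hausdorff_space_subtopology)
    (simp add: Hausdorff_space_product_topology Hausdorff_space_subtopology)

lemma compact_space_HX: "compact_space (HX X)"
proof -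
  have "compact (Hcoord_range X s)" for s by (simp add: Hcoord_range_def Let_def)
  then have "compact_space (Hprod X)"
    unfolding Hprod_def by (auto simp: compact_space_product_topology compact_space_subtopology)
  then show ?thesis
    unfolding HX_def by (intro compact_space_subtopology closedin_compact_space closedin_closure_of)
qed

lemma HX_eq_closure:
  assumes "compact_space X"
  shows "HX X = subtopology (powertop_real (SHM X)) (powertop_real (SHM X) closure_of (Hembed X ` HM X))"
proof -
  let ?P = "powertop_real (SHM X)" and ?B = "PiE (SHM X) (Hcoord_range X)"
  have Hprod: "Hprod X = subtopology ?P ?B"
    unfolding Hprod_def by (simp add: subtopology_product_topology)
  have "closedin ?P ?B"
    unfolding closedin_product_topology by (auto simp: Hcoord_range_def Let_def)
  moreover have "Hembed X ` HM X \<subseteq> ?B"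
    using SHM_in_Hcoord_range[OF assms] by (auto simp: Hembed_def)
  ultimately have "?P closure_of (Hembed X ` HM X) \<subseteq> ?B" "?B \<inter> Hembed X ` HM X = Hembed X ` HM X"
    by (auto dest: closure_of_minimal)
  then show ?thesis
    unfolding HX_def Hprod by (simp add: closure_of_subtopology subtopology_subtopology Int_absorb1)
qed

lemma topspace_HX:
  "compact_space X \<Longrightarrow> topspace (HX X) = powertop_real (SHM X) closure_of (Hembed X ` HM X)"
  by (simp add: HX_eq_closure closure_of_subset_topspace Int_absorb1 flip: topspace_product_topology)

lemma HX_extensional: "z \<in> topspace (HX X) \<Longrightarrow> z \<in> extensional (SHM X)"
  by (auto simp: HX_def Hprod_def PiE_def)

lemma Hembed_in_HX:
  assumes "compact_space X" "\<alpha> \<in> HM X"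
  shows "Hembed X \<alpha> \<in> topspace (HX X)"
proof -
  have "Hembed X ` HM X \<subseteq> topspace (powertop_real (SHM X))" by (auto simp: Hembed_def)
  from closure_of_subset[OF this] show ?thesis using assms by (auto simp: topspace_HX)
qed

lemma HX_dense_induct [consumes 2, case_names closed path]:
  assumes "compact_space X" "z \<in> topspace (HX X)"
    and closed: "closedin (HX X) {z \<in> topspace (HX X). P z}"
    and path: "\<And>\<alpha>. \<alpha> \<in> HM X \<Longrightarrow> P (Hembed X \<alpha>)"
  shows "P z"
proof (rule forall_in_closure_of[OF _ _ closed])
  have "Hembed X ` HM X \<subseteq> topspace (HX X)" using Hembed_in_HX[OF assms(1)] by auto
  then have "HX X closure_of (Hembed X ` HM X) = topspace (HX X)"
    unfolding topspace_HX[OF assms(1)]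
    by (simp add: HX_eq_closure[OF assms(1)] closure_of_subtopology Int_absorb1)
  with assms(2) show "z \<in> HX X closure_of (Hembed X ` HM X)" by simp
qed (use path in auto)

lemma HX_le_if_le_on_paths:
  assumes "compact_space X" "z \<in> topspace (HX X)"
    and g: "continuous_map (HX X) euclideanreal g" and h: "continuous_map (HX X) euclideanreal h"
    and "\<And>\<alpha>. \<alpha> \<in> HM X \<Longrightarrow> g (Hembed X \<alpha>) \<le> h (Hembed X \<alpha>)"
  shows "g z \<le> h z"
  using assms(1,2)
proof (induction rule: HX_dense_induct)
  case closed
  have "closedin (HX X) {z \<in> topspace (HX X). h z - g z \<in> {0..}}"
    by (rule closedin_continuous_map_preimage[OF continuous_map_diff[OF h g]]) simp
  then show ?case by simp
qed (fact assms(5))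

lemma continuous_map_HX_functional:
  assumes "compact_space X" "finite I" "I \<subseteq> SHM X"
  shows "continuous_map (HX X) euclideanreal (\<lambda>z. \<Sum>s\<in>I. l s * z s)"
  unfolding HX_eq_closure[OF assms(1)]
  by (intro continuous_map_from_subtopology continuous_map_linear_functional assms)

lemma continuous_map_HX_coordinate:
  "compact_space X \<Longrightarrow> s \<in> SHM X \<Longrightarrow> continuous_map (HX X) euclideanreal (\<lambda>z. z s)"
  using continuous_map_HX_functional[of X "{s}" "\<lambda>_. 1"] by simp

lemma in_HX_iff:
  assumes "compact_space X"
  shows "z \<in> topspace (HX X) \<longleftrightarrow> z \<in> extensional (SHM X) \<and>
    (\<forall>I e. finite I \<and> I \<subseteq> SHM X \<and> e > 0 \<longrightarrow> (\<exists>\<alpha>\<in>HM X. \<forall>s\<in>I. \<bar>s \<alpha> - z s\<bar> < e))"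
proof -
  have "(\<forall>s\<in>I. \<bar>Hembed X \<alpha> s - z s\<bar> < e) \<longleftrightarrow> (\<forall>s\<in>I. \<bar>s \<alpha> - z s\<bar> < e)" if "I \<subseteq> SHM X" for I \<alpha> e
    using that by (intro ball_cong) (auto simp: Hembed_apply)
  moreover have "Hembed X ` HM X \<subseteq> extensional (SHM X)" using Hembed_extensional by blast
  ultimately show ?thesis
    unfolding topspace_HX[OF assms] by (simp add: in_closure_of_powertop_real cong: conj_cong imp_cong)
qed

lemma convex_family_HX:
  assumes "compact_space X"
  shows "convex_family (SHM X) (topspace (HX X))"
  unfolding convex_family_def
proof (intro ballI)
  fix u v and \<tau> :: real
  assume u: "u \<in> topspace (HX X)" and v: "v \<in> topspace (HX X)" and \<tau>: "\<tau> \<in> {0..1}"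
  have "\<exists>\<gamma>\<in>HM X. \<forall>s\<in>I. \<bar>s \<gamma> - ((1 - \<tau>) * u s + \<tau> * v s)\<bar> < e"
    if I: "finite I" "I \<subseteq> SHM X" "e > 0" for I e
  proof -
    have near: "\<exists>\<alpha>\<in>HM X. \<forall>s\<in>I. \<bar>s \<alpha> - z s\<bar> < e" if "z \<in> topspace (HX X)" for z
      using that I in_HX_iff[OF assms, of z] by simp
    obtain \<alpha> where \<alpha>: "\<alpha> \<in> HM X" "\<And>s. s \<in> I \<Longrightarrow> \<bar>s \<alpha> - u s\<bar> < e" using near[OF u] by blast
    obtain \<beta> where \<beta>: "\<beta> \<in> HM X" "\<And>s. s \<in> I \<Longrightarrow> \<bar>s \<beta> - v s\<bar> < e" using near[OF v] by blast
    obtain \<gamma> where \<gamma>: "\<gamma> \<in> HM X" "\<And>s. s \<in> I \<Longrightarrow> s \<gamma> = (1 - \<tau>) * s \<alpha> + \<tau> * s \<beta>"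
      using SHM_mixture[OF I(1,2) \<alpha>(1) \<beta>(1), of \<tau>] \<tau> by auto
    have "\<bar>s \<gamma> - ((1 - \<tau>) * u s + \<tau> * v s)\<bar> < e" if s: "s \<in> I" for s
    proof -
      have "\<bar>s \<gamma> - ((1 - \<tau>) * u s + \<tau> * v s)\<bar> = \<bar>(1 - \<tau>) * (s \<alpha> - u s) + \<tau> * (s \<beta> - v s)\<bar>"
        by (simp add: \<gamma>(2)[OF s] algebra_simps)
      also have "\<dots> \<le> (1 - \<tau>) * \<bar>s \<alpha> - u s\<bar> + \<tau> * \<bar>s \<beta> - v s\<bar>"
        using \<tau> abs_triangle_ineq[of "(1 - \<tau>) * (s \<alpha> - u s)" "\<tau> * (s \<beta> - v s)"] by (simp add: abs_mult)
      also have "\<dots> < e" using \<tau> \<alpha>(2)[OF s] \<beta>(2)[OF s] by (intro convex_bound_lt) auto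
      finally show ?thesis .
    qed
    then show ?thesis using \<gamma>(1) by blast
  qed
  then show "(\<lambda>s\<in>SHM X. (1 - \<tau>) * u s + \<tau> * v s) \<in> topspace (HX X)"
    unfolding in_HX_iff[OF assms] by (auto simp: subset_iff)
qed

lemma HX_coordinate_le_add:
  assumes "compact_space X" "z \<in> topspace (HX X)" "0 \<le> a" "a < b" "b \<le> 1"
    and "continuous_map X euclideanreal \<phi>" "continuous_map X euclideanreal \<psi>"
    and "\<And>x. x \<in> topspace X \<Longrightarrow> \<phi> x \<le> \<psi> x + c"
  shows "z (HM_fun X \<phi> a b) \<le> z (HM_fun X \<psi> a b) + c"
proof (rule HX_le_if_le_on_paths[OF assms(1,2)])
  have s: "HM_fun X \<phi> a b \<in> SHM X" "HM_fun X \<psi> a b \<in> SHM X"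
    using assms by (simp_all add: HM_fun_in_SHM)
  then show "continuous_map (HX X) euclideanreal (\<lambda>z. z (HM_fun X \<phi> a b))"
    "continuous_map (HX X) euclideanreal (\<lambda>z. z (HM_fun X \<psi> a b) + c)"
    using assms(1) by (auto intro!: continuous_map_add continuous_map_HX_coordinate)
  show "Hembed X \<alpha> (HM_fun X \<phi> a b) \<le> Hembed X \<alpha> (HM_fun X \<psi> a b) + c" if "\<alpha> \<in> HM X" for \<alpha>
    using HM_fun_le_add[OF that assms(3-5,8)] s by (simp add: Hembed_apply)
qed

definition extends_to_HX :: "'a topology \<Rightarrow> ((real \<Rightarrow> 'a) \<Rightarrow> real) \<Rightarrow> bool" where
  "extends_to_HX X F \<longleftrightarrow>
     (\<exists>L. continuous_map (HX X) euclideanreal L \<and> (\<forall>\<alpha>\<in>HM X. L (Hembed X \<alpha>) = F \<alpha>))"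

lemma extends_to_HX_cong:
  "extends_to_HX X F \<Longrightarrow> (\<And>\<alpha>. \<alpha> \<in> HM X \<Longrightarrow> F \<alpha> = F' \<alpha>) \<Longrightarrow> extends_to_HX X F'"
  by (simp add: extends_to_HX_def)

lemma extends_to_HX_add:
  assumes "extends_to_HX X F" "extends_to_HX X F'"
  shows "extends_to_HX X (\<lambda>\<alpha>. F \<alpha> + F' \<alpha>)"
proof -
  obtain L L' where "continuous_map (HX X) euclideanreal L" "\<forall>\<alpha>\<in>HM X. L (Hembed X \<alpha>) = F \<alpha>"
    "continuous_map (HX X) euclideanreal L'" "\<forall>\<alpha>\<in>HM X. L' (Hembed X \<alpha>) = F' \<alpha>"
    using assms by (auto simp: extends_to_HX_def)
  then show ?thesis
    unfolding extends_to_HX_def by (intro exI[of _ "\<lambda>z. L z + L' z"]) (auto intro: continuous_map_add)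
qed

lemma extends_to_HX_path_integral_const:
  assumes "compact_space X" "continuous_map X euclideanreal \<phi>" "0 \<le> a" "a < b" "b \<le> 1"
  shows "extends_to_HX X (path_integral (\<lambda>t. \<phi>) a b)"
proof -
  have s: "HM_fun X \<phi> a b \<in> SHM X" using assms by (simp add: HM_fun_in_SHM)
  then have "continuous_map (HX X) euclideanreal (\<lambda>z. (b - a) * z (HM_fun X \<phi> a b))"
    by (intro continuous_map_real_mult_left continuous_map_HX_coordinate assms)
  moreover have "(b - a) * Hembed X \<alpha> (HM_fun X \<phi> a b) = path_integral (\<lambda>t. \<phi>) a b \<alpha>" if "\<alpha> \<in> HM X" for \<alpha>
    using s that assms(4) by (simp add: Hembed_apply HM_fun_eq_path_integral)
  ultimately show ?thesis unfolding extends_to_HX_def by blast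
qed

lemma extends_to_HX_path_integral:
  assumes "compact_space X" "step_integrand X S G" "0 \<le> a" "a < b" "b \<le> 1"
  shows "extends_to_HX X (path_integral G a b)"
proof -
  have G: "finite S" "step_on S G" "\<And>t. continuous_map X euclideanreal (G t)"
    using assms(2) by (auto simp: step_integrand_def)
  have "0 \<le> a \<longrightarrow> b \<le> 1 \<longrightarrow> extends_to_HX X (path_integral G a b)"
    using G(1) assms(4)
  proof (induction rule: breakpoint_induct)
    case (cell a b)
    have "path_integral (\<lambda>t. G a) a b \<alpha> = path_integral G a b \<alpha>" for \<alpha>
      by (rule path_integral_cong) (subst step_on_cell[OF G(2) cell(2)], auto)
    then show ?case
      using extends_to_HX_path_integral_const[OF assms(1) G(3) _ cell(1)] by (auto intro: extends_to_HX_cong)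
  next
    case (join a c b)
    show ?case
    proof (intro impI)
      assume "0 \<le> a" "b \<le> 1"
      then have "extends_to_HX X (\<lambda>\<alpha>. path_integral G a c \<alpha> + path_integral G c b \<alpha>)"
        using join by (intro extends_to_HX_add) auto
      then show "extends_to_HX X (path_integral G a b)"
        by (rule extends_to_HX_cong) (rule path_integral_combine[OF G(1,2), symmetric], use join(1,2) in auto)
    qed
  qed
  then show ?thesis using assms(3,5) by blast
qed

lemma Hembed_HM_const_coordinate:
  assumes "x \<in> topspace X" "continuous_map X euclideanreal \<phi>" "0 \<le> a" "a < b" "b \<le> 1"
  shows "Hembed X (HM_const x) (HM_fun X \<phi> a b) = \<phi> x"
  using assms by (simp add: Hembed_apply HM_fun_in_SHM HM_fun_HM_const)

lemma continuous_map_Hembed_HM_const: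
  assumes "compact_space X"
  shows "continuous_map X (HX X) (\<lambda>x. Hembed X (HM_const x))"
  unfolding HX_eq_closure[OF assms]
proof (rule continuous_map_into_subtopology)
  have "continuous_map X euclideanreal (\<lambda>x. s (HM_const x))" if "s \<in> SHM X" for s
  proof -
    obtain \<phi> a b where s: "s = HM_fun X \<phi> a b" "continuous_map X euclideanreal \<phi>" "0 \<le> a" "a < b" "b \<le> 1"
      using SHM_cases[OF \<open>s \<in> SHM X\<close>] .
    show ?thesis
      by (rule continuous_map_eq[OF s(2)]) (simp add: s HM_fun_HM_const)
  qed
  then show "continuous_map X (powertop_real (SHM X)) (\<lambda>x. Hembed X (HM_const x))"
    by (auto simp: continuous_map_componentwise Hembed_def)
  show "(\<lambda>x. Hembed X (HM_const x)) \<in> topspace X \<rightarrow> powertop_real (SHM X) closure_of (Hembed X ` HM X)"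
    using Hembed_in_HX[OF assms] by (auto simp: HM_const_in_HM simp flip: topspace_HX[OF assms])
qed

section \<open>The map $Hf$\<close>

definition HM_map :: "('a \<Rightarrow> 'b) \<Rightarrow> (real \<Rightarrow> 'a) \<Rightarrow> real \<Rightarrow> 'b" where
  "HM_map f \<alpha> = (\<lambda>t\<in>{0..<1}. f (\<alpha> t))"

lemma HM_map_HM_const: "HM_map f (HM_const x) = HM_const (f x)"
  by (auto simp: HM_map_def HM_const_def)

definition SHM_pullback :: "'a topology \<Rightarrow> ('a \<Rightarrow> 'b) \<Rightarrow> ((real \<Rightarrow> 'b) \<Rightarrow> real) \<Rightarrow> (real \<Rightarrow> 'a) \<Rightarrow> real" where
  "SHM_pullback X f s = (\<lambda>\<alpha>\<in>HM X. s (HM_map f \<alpha>))"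

definition HX_pushforward :: "'a topology \<Rightarrow> 'b topology \<Rightarrow> ('a \<Rightarrow> 'b)
     \<Rightarrow> (((real \<Rightarrow> 'a) \<Rightarrow> real) \<Rightarrow> real) \<Rightarrow> (((real \<Rightarrow> 'b) \<Rightarrow> real) \<Rightarrow> real)" where
  "HX_pushforward X Y f z = (\<lambda>s\<in>SHM Y. z (SHM_pullback X f s))"

context compact_map
begin

lemma HM_map_in_HM:
  assumes "\<alpha> \<in> HM X"
  shows "HM_map f \<alpha> \<in> HM Y"
proof -
  obtain S where "finite S" "step_on S \<alpha>" using HM_breakpoints[OF assms] .
  then show ?thesis
    unfolding HM_map_def
    by (rule restrict_in_HM[OF _ step_on_compose]) (intro image_in_topspace HM_in_topspace[OF assms])
qed

lemma HM_fun_HM_map: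
  assumes "\<alpha> \<in> HM X" "0 \<le> a" "b \<le> 1"
  shows "HM_fun Y \<psi> a b (HM_map f \<alpha>) = HM_fun X (\<psi> \<circ> f) a b \<alpha>"
proof -
  have "path_integral (\<lambda>t. \<psi>) a b (HM_map f \<alpha>) = path_integral (\<lambda>t. \<psi> \<circ> f) a b \<alpha>"
    by (rule path_integral_cong) (use assms in \<open>simp add: HM_map_def\<close>)
  then show ?thesis using HM_map_in_HM[OF assms(1)] assms(1) by (simp add: HM_fun_eq_path_integral)
qed

lemma SHM_pullback_HM_fun:
  assumes "0 \<le> a" "b \<le> 1"
  shows "SHM_pullback X f (HM_fun Y \<psi> a b) = HM_fun X (\<psi> \<circ> f) a b"
proof (rule extensionalityI)
  show "SHM_pullback X f (HM_fun Y \<psi> a b) \<in> extensional (HM X)" by (simp add: SHM_pullback_def)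
  show "HM_fun X (\<psi> \<circ> f) a b \<in> extensional (HM X)" by (simp add: HM_fun_def)
qed (simp add: SHM_pullback_def HM_fun_HM_map assms)

lemma SHM_pullback_in_SHM:
  assumes "s \<in> SHM Y"
  shows "SHM_pullback X f s \<in> SHM X"
proof -
  obtain \<psi> a b where "s = HM_fun Y \<psi> a b" "continuous_map Y euclideanreal \<psi>" "0 \<le> a" "a < b" "b \<le> 1"
    using SHM_cases[OF assms] .
  then show ?thesis
    by (simp add: SHM_pullback_HM_fun HM_fun_in_SHM continuous_map_compose[OF continuous])
qed

lemma HX_pushforward_Hembed:
  assumes "\<alpha> \<in> HM X"
  shows "HX_pushforward X Y f (Hembed X \<alpha>) = Hembed Y (HM_map f \<alpha>)"
proof -
  have "SHM_pullback X f s \<alpha> = s (HM_map f \<alpha>)" for s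
    using assms by (simp add: SHM_pullback_def)
  then show ?thesis
    by (auto simp: HX_pushforward_def Hembed_apply SHM_pullback_in_SHM Hembed_def[of Y])
qed

lemma continuous_map_HX_pushforward: "continuous_map (HX X) (HX Y) (HX_pushforward X Y f)"
proof -
  let ?P = "powertop_real (SHM X)" and ?Q = "powertop_real (SHM Y)"
  have cont: "continuous_map ?P ?Q (HX_pushforward X Y f)"
    unfolding continuous_map_componentwise
    by (auto simp: HX_pushforward_def SHM_pullback_in_SHM intro!: continuous_map_product_projection)
  have "HX_pushforward X Y f ` Hembed X ` HM X \<subseteq> Hembed Y ` HM Y"
    using HX_pushforward_Hembed HM_map_in_HM by auto
  then have "HX_pushforward X Y f ` (?P closure_of (Hembed X ` HM X)) \<subseteq> ?Q closure_of (Hembed Y ` HM Y)"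
    using continuous_map_image_closure_subset[OF cont] closure_of_mono by blast
  then show ?thesis
    unfolding HX_eq_closure[OF compact_domain] HX_eq_closure[OF compact_codomain]
    by (intro continuous_map_into_subtopology continuous_map_from_subtopology cont) auto
qed

lemma Hmap_eq_HX_pushforward: "Hmap X Y f = restrict (HX_pushforward X Y f) (topspace (HX X))"
  unfolding Hmap_def
proof (rule the_equality, intro conjI allI impI ballI; (elim conjE)?)
  show "continuous_map (HX X) (HX Y) (restrict (HX_pushforward X Y f) (topspace (HX X)))"
    using continuous_map_HX_pushforward by (rule continuous_map_eq) simp
next
  fix \<psi> a b z
  assume "continuous_map Y euclideanreal \<psi>" "0 \<le> a" "a < b" "b \<le> (1::real)" "z \<in> topspace (HX X)"
  then show "restrict (HX_pushforward X Y f) (topspace (HX X)) z (HM_fun Y \<psi> a b) = z (HM_fun X (\<psi> \<circ> f) a b)"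
    by (simp add: HX_pushforward_def HM_fun_in_SHM SHM_pullback_HM_fun)
next
  fix g
  assume g: "g \<in> extensional (topspace (HX X))" "continuous_map (HX X) (HX Y) g"
    and coordinates: "\<forall>\<psi> a b. continuous_map Y euclideanreal \<psi> \<and> 0 \<le> a \<and> a < b \<and> b \<le> 1 \<longrightarrow>
      (\<forall>z\<in>topspace (HX X). g z (HM_fun Y \<psi> a b) = z (HM_fun X (\<psi> \<circ> f) a b))"
  have "g z = HX_pushforward X Y f z" if z: "z \<in> topspace (HX X)" for z
  proof (rule extensionalityI[where A = "SHM Y"])
    show "g z \<in> extensional (SHM Y)"
      using z g(2) by (intro HX_extensional) (auto simp: continuous_map_def)
    show "HX_pushforward X Y f z \<in> extensional (SHM Y)" by (simp add: HX_pushforward_def)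
    fix s assume "s \<in> SHM Y"
    moreover from this obtain \<psi> a b where "s = HM_fun Y \<psi> a b" "continuous_map Y euclideanreal \<psi>"
      "0 \<le> a" "a < b" "b \<le> 1"
      by (rule SHM_cases)
    ultimately show "g z s = HX_pushforward X Y f z s"
      using coordinates z by (simp add: HX_pushforward_def SHM_pullback_HM_fun)
  qed
  then show "g = restrict (HX_pushforward X Y f) (topspace (HX X))"
    by (intro extensionalityI[OF g(1)]) auto
qed simp

lemma Hmap_apply:
  "z \<in> topspace (HX X) \<Longrightarrow> s \<in> SHM Y \<Longrightarrow> Hmap X Y f z s = z (SHM_pullback X f s)"
  by (simp add: Hmap_eq_HX_pushforward HX_pushforward_def)

lemma Hmap_Hembed:
  "\<alpha> \<in> HM X \<Longrightarrow> Hmap X Y f (Hembed X \<alpha>) = Hembed Y (HM_map f \<alpha>)"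
  by (simp add: Hmap_eq_HX_pushforward HX_pushforward_Hembed Hembed_in_HX compact_domain)

lemma compact_map_Hmap: "compact_map (HX X) (HX Y) (Hmap X Y f)"
proof
  show "continuous_map (HX X) (HX Y) (Hmap X Y f)"
    unfolding Hmap_eq_HX_pushforward
    using continuous_map_HX_pushforward by (rule continuous_map_eq) simp
qed (simp_all add: compact_space_HX Hausdorff_space_HX)

lemma convex_family_Hmap_fibre: "convex_family (SHM X) {z \<in> topspace (HX X). Hmap X Y f z = w}"
  unfolding convex_family_def
proof (intro ballI)
  fix u v and \<tau> :: real
  assume u: "u \<in> {z \<in> topspace (HX X). Hmap X Y f z = w}"
    and v: "v \<in> {z \<in> topspace (HX X). Hmap X Y f z = w}" and \<tau>: "\<tau> \<in> {0..1}"
  define z where "z = (\<lambda>s\<in>SHM X. (1 - \<tau>) * u s + \<tau> * v s)"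
  have z: "z \<in> topspace (HX X)"
    using convex_family_HX[OF compact_domain] u v \<tau> by (simp add: convex_family_def z_def)
  have "Hmap X Y f z = Hmap X Y f u"
  proof (rule extensionalityI[where A = "SHM Y"])
    show "Hmap X Y f z \<in> extensional (SHM Y)" "Hmap X Y f u \<in> extensional (SHM Y)"
      using z u compact_map.image_in_topspace[OF compact_map_Hmap] by (auto intro: HX_extensional)
    fix s assume s: "s \<in> SHM Y"
    then have "u (SHM_pullback X f s) = v (SHM_pullback X f s)"
      using u v Hmap_apply[of u s] Hmap_apply[of v s] by simp
    then have "z (SHM_pullback X f s) = u (SHM_pullback X f s)"
      using s by (simp add: z_def SHM_pullback_in_SHM algebra_simps)
    then show "Hmap X Y f z s = Hmap X Y f u s"
      using s u Hmap_apply[OF z s] Hmap_apply[of u s] by simp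
  qed
  then show "(\<lambda>s\<in>SHM X. (1 - \<tau>) * u s + \<tau> * v s) \<in> {z \<in> topspace (HX X). Hmap X Y f z = w}"
    using z u by (simp add: z_def)
qed

lemma HX_subset_Hmap_image:
  assumes "closedin (HX X) C"
    and lift: "\<And>\<beta>. \<beta> \<in> HM Y \<Longrightarrow> \<exists>\<alpha>\<in>HM X. HM_map f \<alpha> = \<beta> \<and> Hembed X \<alpha> \<in> C"
  shows "topspace (HX Y) \<subseteq> Hmap X Y f ` C"
proof
  fix w assume "w \<in> topspace (HX Y)"
  with compact_codomain show "w \<in> Hmap X Y f ` C"
  proof (induction rule: HX_dense_induct)
    case closed
    have "closedin (HX Y) (Hmap X Y f ` C)"
      using compact_map.closedin_image[OF compact_map_Hmap assms(1)] .
    moreover from this have "{w \<in> topspace (HX Y). w \<in> Hmap X Y f ` C} = Hmap X Y f ` C"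
      using closedin_subset by blast
    ultimately show ?case by simp
  next
    case (path \<beta>)
    then show ?case using lift Hmap_Hembed by (metis imageI)
  qed
qed

lemma HM_lift:
  assumes "finite S" "step_on S m" "\<beta> \<in> HM Y"
    and right_inverse: "\<And>t y. y \<in> topspace Y \<Longrightarrow> m t y \<in> topspace X \<and> f (m t y) = y"
  shows "(\<lambda>t\<in>{0..<1}. m t (\<beta> t)) \<in> HM X" "HM_map f (\<lambda>t\<in>{0..<1}. m t (\<beta> t)) = \<beta>"
proof -
  obtain T where T: "finite T" "step_on T \<beta>" using HM_breakpoints[OF assms(3)] .
  show "(\<lambda>t\<in>{0..<1}. m t (\<beta> t)) \<in> HM X"
    by (rule restrict_in_HM[OF _ step_on_eval[OF assms(2) T(2)]])
      (use T(1) assms(1) right_inverse HM_in_topspace[OF assms(3)] in auto)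
  show "HM_map f (\<lambda>t\<in>{0..<1}. m t (\<beta> t)) = \<beta>"
    using right_inverse HM_in_topspace[OF assms(3)] HM_undefined[OF assms(3)]
    by (auto simp: HM_map_def restrict_def fun_eq_iff)
qed

lemma path_integral_le_fibre_Sup:
  assumes G: "step_integrand X S G" and "\<alpha> \<in> HM X"
  shows "path_integral G 0 1 \<alpha> \<le> path_integral (\<lambda>t. fibre_Sup X f (G t)) 0 1 (HM_map f \<alpha>)"
proof -
  have steps: "finite S" "step_on S G" "step_on S (\<lambda>t. fibre_Sup X f (G t))"
    using G step_on_compose[of S G "fibre_Sup X f"] by (auto simp: step_integrand_def)
  show ?thesis
  proof (rule path_integral_mono[OF steps(1,2) assms(2) steps(1,3) HM_map_in_HM[OF assms(2)]])
    fix t :: real assume "0 < t" "t < 1"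
    then show "G t (\<alpha> t) \<le> fibre_Sup X f (G t) (HM_map f \<alpha> t)"
      using G fibre_Sup_upper[of "G t" "\<alpha> t"] HM_in_topspace[OF assms(2), of t]
      by (simp add: step_integrand_def HM_map_def)
  qed
qed

text \<open>The majorant is a Urysohn function on \<open>Y\<close> that is large on the image of \<open>{\<phi> \<ge> c}\<close>.\<close>
lemma continuous_fibre_majorant:
  assumes "y \<in> topspace Y" "continuous_map X euclideanreal \<phi>"
    and below: "\<And>x. x \<in> topspace X \<Longrightarrow> f x = y \<Longrightarrow> \<phi> x < c"
  obtains \<psi> where "continuous_map Y euclideanreal \<psi>" "\<psi> y = 0"
    "\<And>x. x \<in> topspace X \<Longrightarrow> \<phi> x \<le> \<psi> (f x) + c"
proof -
  define E where "E = {x \<in> topspace X. \<phi> x \<in> {c..}}"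
  have "closedin X E" unfolding E_def by (rule closedin_continuous_map_preimage[OF assms(2)]) simp
  then have "closedin Y (f ` E)" by (rule closedin_image)
  have "y \<notin> f ` E" using below by (force simp: E_def)
  have "compact (\<phi> ` topspace X)"
    using image_compactin[OF _ assms(2)] compact_domain by (fastforce simp: compact_space_def)
  then obtain B where B: "\<And>x. x \<in> topspace X \<Longrightarrow> \<phi> x \<le> B"
    by (metis bounded_imp_bdd_above[OF compact_imp_bounded] bdd_above.E imageI)
  obtain \<psi> where \<psi>: "continuous_map Y euclideanreal \<psi>" "\<psi> y = 0"
    "\<And>u. u \<in> topspace Y \<Longrightarrow> 0 \<le> \<psi> u" "\<And>u. u \<in> f ` E \<Longrightarrow> \<psi> u = \<bar>B - c\<bar>"
    by (rule Urysohn_point[OF compact_codomain Hausdorff_codomain assms(1) \<open>closedin Y (f ` E)\<close>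
          \<open>y \<notin> f ` E\<close> abs_ge_zero]) blast
  have "\<phi> x \<le> \<psi> (f x) + c" if x: "x \<in> topspace X" for x
  proof (cases "x \<in> E")
    case True
    then show ?thesis using \<psi>(4)[of "f x"] B[OF x] by simp
  next
    case False
    then show ?thesis using x \<psi>(3)[OF image_in_topspace[OF x]] by (simp add: E_def)
  qed
  with \<psi>(1,2) show thesis by (rule that)
qed

lemma Hmap_fibre_coordinate_le:
  assumes y: "y \<in> topspace Y" and z: "z \<in> topspace (HX X)" "Hmap X Y f z = Hembed Y (HM_const y)"
    and \<phi>: "continuous_map X euclideanreal \<phi>" "\<And>x. x \<in> topspace X \<Longrightarrow> f x = y \<Longrightarrow> \<phi> x < c"
    and ab: "0 \<le> a" "a < b" "b \<le> 1"
  shows "z (HM_fun X \<phi> a b) \<le> c"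
proof -
  obtain \<psi> where \<psi>: "continuous_map Y euclideanreal \<psi>" "\<psi> y = 0"
    "\<And>x. x \<in> topspace X \<Longrightarrow> \<phi> x \<le> \<psi> (f x) + c"
    using continuous_fibre_majorant[OF y \<phi>] by blast
  have "z (HM_fun X \<phi> a b) \<le> z (HM_fun X (\<psi> \<circ> f) a b) + c"
    by (rule HX_coordinate_le_add[OF compact_domain z(1) ab \<phi>(1) continuous_map_compose[OF continuous \<psi>(1)]])
      (simp add: \<psi>(3))
  also have "z (HM_fun X (\<psi> \<circ> f) a b) = Hmap X Y f z (HM_fun Y \<psi> a b)"
    using z(1) ab \<psi>(1) by (simp add: Hmap_apply HM_fun_in_SHM SHM_pullback_HM_fun)
  also have "\<dots> = \<psi> y"
    using ab y \<psi>(1) by (simp add: z(2) Hembed_HM_const_coordinate)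
  finally show ?thesis using \<psi>(2) by simp
qed

lemma Hmap_Hembed_HM_const:
  "x \<in> topspace X \<Longrightarrow> Hmap X Y f (Hembed X (HM_const x)) = Hembed Y (HM_const (f x))"
  by (simp add: Hmap_Hembed HM_const_in_HM HM_map_HM_const)

lemma open_Hmap_neighbourhood:
  assumes "Hausdorff_space X" "open_map (HX X) (HX Y) (Hmap X Y f)" "openin X U" "x \<in> U"
  obtains V where "openin Y V" "f x \<in> V" "V \<subseteq> f ` U"
proof -
  have x: "x \<in> topspace X" using assms(3,4) openin_subset by blast
  have "closedin X (topspace X - U)" "x \<notin> topspace X - U" using assms(3,4) by auto
  then obtain \<psi> :: "'a \<Rightarrow> real" where \<psi>: "continuous_map X euclideanreal \<psi>" "\<psi> x = 0"
    "\<And>u. u \<in> topspace X - U \<Longrightarrow> \<psi> u = 1"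
    by (rule Urysohn_point[OF compact_domain assms(1) x _ _ zero_le_one]) blast
  define \<phi> where "\<phi> u = 1 - \<psi> u" for u
  have \<phi>: "continuous_map X euclideanreal \<phi>" "\<phi> x = 1" "\<And>u. u \<in> topspace X - U \<Longrightarrow> \<phi> u = 0"
    using \<psi> by (auto simp: \<phi>_def[abs_def] intro: continuous_map_diff)
  define W where "W = {z \<in> topspace (HX X). z (HM_fun X \<phi> 0 1) \<in> {1/2<..}}"
  define V where "V = {y \<in> topspace Y. Hembed Y (HM_const y) \<in> Hmap X Y f ` W}"
  show thesis
  proof
    have "openin (HX X) W"
      unfolding W_def
      by (rule openin_continuous_map_preimage[OF continuous_map_HX_coordinate[OF compact_domain]])
        (use \<phi>(1) in \<open>simp_all add: HM_fun_in_SHM\<close>)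
    then show "openin Y V"
      unfolding V_def
      by (intro openin_continuous_map_preimage[OF continuous_map_Hembed_HM_const[OF compact_codomain]])
        (use assms(2) in \<open>simp add: open_map_def\<close>)
    have "Hembed X (HM_const x) \<in> W"
      using x \<phi>(1,2) by (simp add: W_def Hembed_HM_const_coordinate Hembed_in_HX compact_domain HM_const_in_HM)
    then show "f x \<in> V"
      using Hmap_Hembed_HM_const[OF x] image_in_topspace[OF x] by (auto simp: V_def image_iff intro!: bexI)
    show "V \<subseteq> f ` U"
    proof (rule ccontr)
      assume "\<not> V \<subseteq> f ` U"
      then obtain y where y: "y \<in> V" "y \<notin> f ` U" by blast
      then obtain z where z: "z \<in> W" "Hmap X Y f z = Hembed Y (HM_const y)"
        by (force simp: V_def)
      have "\<phi> u < 1/2" if "u \<in> topspace X" "f u = y" for u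
        using \<phi>(3)[of u] y(2) that by fastforce
      then show False
        using Hmap_fibre_coordinate_le[of y z \<phi> "1/2" 0 1] \<phi>(1) y(1) z by (force simp: W_def V_def)
    qed
  qed
qed

theorem open_map_if_open_Hmap:
  assumes "Hausdorff_space X" "open_map (HX X) (HX Y) (Hmap X Y f)"
  shows "open_map X Y f"
  unfolding open_map_def
proof (intro allI impI)
  fix U assume "openin X U"
  then have "\<exists>V. openin Y V \<and> f x \<in> V \<and> V \<subseteq> f ` U" if "x \<in> U" for x
    using open_Hmap_neighbourhood[OF assms] that by metis
  then show "openin Y (f ` U)" by (subst openin_subopen) blast
qed

end

context compact_surjection
begin

lemma compact_surjection_Hmap: "compact_surjection (HX X) (HX Y) (Hmap X Y f)"
proof -
  interpret H: compact_map "HX X" "HX Y" "Hmap X Y f" by (rule compact_map_Hmap)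
  have inv: "inv_into (topspace X) f y \<in> topspace X \<and> f (inv_into (topspace X) f y) = y" if "y \<in> topspace Y" for y
    using that by (simp add: inv_into_into f_inv_into_f surjective)
  have "\<exists>\<alpha>\<in>HM X. HM_map f \<alpha> = \<beta>" if "\<beta> \<in> HM Y" for \<beta>
    using HM_lift[OF finite.emptyI step_on_const that inv] by blast
  then have "topspace (HX Y) \<subseteq> Hmap X Y f ` topspace (HX X)"
    by (intro HX_subset_Hmap_image) (auto simp: Hembed_in_HX compact_domain)
  then show ?thesis by unfold_locales (use H.image_in_topspace in auto)
qed

lemma path_integral_fibre_Sup_attained:
  assumes G: "step_integrand X S G" and \<beta>: "\<beta> \<in> HM Y"
  obtains \<alpha> where "\<alpha> \<in> HM X" "HM_map f \<alpha> = \<beta>"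
    "path_integral G 0 1 \<alpha> = path_integral (\<lambda>t. fibre_Sup X f (G t)) 0 1 \<beta>"
proof -
  define argmax where "argmax g y = (SOME x. x \<in> topspace X \<and> f x = y \<and> g x = fibre_Sup X f g y)" for g y
  have argmax: "argmax g y \<in> topspace X \<and> f (argmax g y) = y \<and> g (argmax g y) = fibre_Sup X f g y"
    if "continuous_map X euclideanreal g" "y \<in> topspace Y" for g y
    unfolding argmax_def by (rule someI_ex) (use fibre_Sup_attained[OF that(1)] that(2) surjective in metis)
  define \<alpha> where "\<alpha> = (\<lambda>t\<in>{0..<1}. argmax (G t) (\<beta> t))"
  have cont: "continuous_map X euclideanreal (G t)" for t using G by (simp add: step_integrand_def)
  have "finite S" "step_on S (\<lambda>t. argmax (G t))"
    using G step_on_compose[of S G] by (auto simp: step_integrand_def)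
  then have "\<alpha> \<in> HM X" "HM_map f \<alpha> = \<beta>"
    unfolding \<alpha>_def using HM_lift[OF _ _ \<beta>] argmax[OF cont] by blast+
  moreover have "path_integral G 0 1 \<alpha> = path_integral (\<lambda>t. fibre_Sup X f (G t)) 0 1 \<beta>"
    by (rule path_integral_cong) (use argmax[OF cont] HM_in_topspace[OF \<beta>] in \<open>simp add: \<alpha>_def\<close>)
  ultimately show thesis using that by blast
qed

lemma continuous_fibre_Sup_Hmap:
  assumes "open_map X Y f" and G: "step_integrand X S G"
    and L: "continuous_map (HX X) euclideanreal L" "\<And>\<alpha>. \<alpha> \<in> HM X \<Longrightarrow> L (Hembed X \<alpha>) = path_integral G 0 1 \<alpha>"
  shows "continuous_map (HX Y) euclideanreal (fibre_Sup (HX X) (Hmap X Y f) L)"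
proof -
  interpret H: compact_map "HX X" "HX Y" "Hmap X Y f" by (rule compact_map_Hmap)
  have "step_integrand Y S (\<lambda>t. fibre_Sup X f (G t))"
    using G continuous_map_fibre_Sup[OF assms(1)] step_on_compose[of S G "fibre_Sup X f"]
    by (simp add: step_integrand_def)
  then obtain M where M: "continuous_map (HX Y) euclideanreal M"
    "\<And>\<beta>. \<beta> \<in> HM Y \<Longrightarrow> M (Hembed Y \<beta>) = path_integral (\<lambda>t. fibre_Sup X f (G t)) 0 1 \<beta>"
    using extends_to_HX_path_integral[OF compact_codomain _ order_refl zero_less_one order_refl]
    unfolding extends_to_HX_def by metis
  have MH: "continuous_map (HX X) euclideanreal (\<lambda>z. M (Hmap X Y f z))"
    using continuous_map_compose[OF H.continuous M(1)] by (simp add: o_def)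
  have upper: "L z \<le> M (Hmap X Y f z)" if "z \<in> topspace (HX X)" for z
    using compact_domain that L(1) MH
    by (rule HX_le_if_le_on_paths)
      (simp add: L(2) M(2) Hmap_Hembed HM_map_in_HM path_integral_le_fibre_Sup[OF G])
  define C where "C = {z \<in> topspace (HX X). L z - M (Hmap X Y f z) \<in> {0}}"
  have "closedin (HX X) C"
    unfolding C_def by (rule closedin_continuous_map_preimage[OF continuous_map_diff[OF L(1) MH]]) simp
  moreover have "\<exists>\<alpha>\<in>HM X. HM_map f \<alpha> = \<beta> \<and> Hembed X \<alpha> \<in> C" if "\<beta> \<in> HM Y" for \<beta>
    using path_integral_fibre_Sup_attained[OF G that] that
    by (metis (no_types, lifting) C_def Hembed_in_HX Hmap_Hembed L(2) M(2) compact_domain diff_self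
        mem_Collect_eq singletonI)
  ultimately have "topspace (HX Y) \<subseteq> Hmap X Y f ` C" by (rule HX_subset_Hmap_image)
  then have "fibre_Sup (HX X) (Hmap X Y f) L w = M w" if "w \<in> topspace (HX Y)" for w
    using that upper by (force simp: C_def intro: fibre_Sup_eqI)
  then show ?thesis using continuous_map_eq[OF M(1)] by simp
qed

lemma continuous_linear_fibre_Sup_Hmap:
  assumes "open_map X Y f" "finite I" "I \<subseteq> SHM X"
  shows "continuous_map (HX Y) euclideanreal (fibre_Sup (HX X) (Hmap X Y f) (\<lambda>z. \<Sum>s\<in>I. l s * z s))"
proof -
  obtain S G where G: "step_integrand X S G"
    "\<And>\<alpha>. \<alpha> \<in> HM X \<Longrightarrow> (\<Sum>s\<in>I. l s * s \<alpha>) = path_integral G 0 1 \<alpha>"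
    by (rule SHM_linear_representation[OF assms(2,3), of l]) blast
  show ?thesis
  proof (rule continuous_fibre_Sup_Hmap[OF assms(1) G(1)])
    show "continuous_map (HX X) euclideanreal (\<lambda>z. \<Sum>s\<in>I. l s * z s)"
      by (rule continuous_map_HX_functional[OF compact_domain assms(2,3)])
    have "(\<Sum>s\<in>I. l s * Hembed X \<alpha> s) = (\<Sum>s\<in>I. l s * s \<alpha>)" for \<alpha>
      using assms(3) by (intro sum.cong) (auto simp: Hembed_apply)
    then show "(\<Sum>s\<in>I. l s * Hembed X \<alpha> s) = path_integral G 0 1 \<alpha>" if "\<alpha> \<in> HM X" for \<alpha>
      using G(2)[OF that] by simp
  qed
qed

theorem open_Hmap_if_open_map:
  assumes "open_map X Y f"
  shows "open_map (HX X) (HX Y) (Hmap X Y f)"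
proof -
  let ?K = "powertop_real (SHM X) closure_of (Hembed X ` HM X)"
  note HX = HX_eq_closure[OF compact_domain]
  interpret H: convex_fibred_surjection "SHM X" ?K "HX Y" "Hmap X Y f"
    unfolding convex_fibred_surjection_def convex_fibred_surjection_axioms_def HX[symmetric]
    using compact_surjection_Hmap convex_family_Hmap_fibre by blast
  show ?thesis
    using H.open_map_if_continuous_linear_fibre_Sup continuous_linear_fibre_Sup_Hmap[OF assms]
    unfolding HX[symmetric] by blast
qed

end

theorem theorem1p1:
  fixes X :: "'a topology" and Y :: "'b topology" and f :: "'a \<Rightarrow> 'b"
  assumes "compact_space X" and "Hausdorff_space X"
    and "compact_space Y" and "Hausdorff_space Y"
    and "continuous_map X Y f" and "f ` topspace X = topspace Y"
  shows "open_map (HX X) (HX Y) (Hmap X Y f) \<longleftrightarrow> open_map X Y f"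
proof -
  interpret compact_surjection X Y f by unfold_locales (use assms in auto)
  show ?thesis using open_Hmap_if_open_map open_map_if_open_Hmap[OF assms(2)] by blast
qed

end
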